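(* Let $\mathbf{G}$ be a Carnot group with first layer $V_1$, let $\Omega\subset\mathbf{G}$, and let $c:\mathbf{G}\times V_1\to\mathbb{R}$ be such that $c(\cdot,v)\in\Gamma^{1,1}_{\rm loc}(\mathbf{G})$ for every $v\in V_1$, with Lipschitz bound uniform in $v$, i.e., for every open ball $B\subset\Omega$ there exists $K_B>0$ such that $$\|\mathbb{X}c(g',v)-\mathbb{X}c(g,v)\|\le 2K_B\,d(g',g),\qquad\forall g,g'\in B,\ \forall v\in V_1 .$$ Let $\psi:\Omega\to(-\infty,+\infty]$ be a proper $c$ H--convex function. Then $\psi$ is locally H--semiconvex in $\Omega$.
   Context: A Carnot group $\mathbf{G}$ of step $r$ is a connected, simply connected, nilpotent Lie group whose Lie algebra $\mathfrak{g}$ of left--invariant vector fields is stratified: $\mathfrak{g}=V_1\oplus\dots\oplus V_r$ with $V_j\ne\{0\}$, $[V_1,V_j]=V_{j+1}$ for $1\le j\le r-1$, $[V_1,V_r]=0$. A scalar product $\langle\cdot,\cdot\rangle$ is fixed on $\mathfrak{g}$ making the layers mutually orthogonal, with Euclidean norm $|\cdot|$; on $V_1$ this norm is also written $\|\cdot\|$. The map $\exp:\mathfrak{g}\to\mathbf{G}$ is a global diffeomorphism with inverse $\xi=(\xi_1,\dots,\xi_r)$, $\xi_j:\mathbf{G}\to V_j$. Dilations: $\delta_\lambda(g)=\exp(\lambda\xi_1(g)+\dots+\lambda^r\xi_r(g))$. Gauge pseudo--norm: $\|g\|_{\mathbf{G}}=\big(\sum_{i=1}^r|\xi_i(g)|^{2r!/i}\big)^{1/(2r!)}$;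 gauge pseudo--distance: $d(g,g')=\|g^{-1}g'\|_{\mathbf{G}}$. All balls are balls for $d$; by the paper's convention these balls are H--convex sets. Fix an orthonormal basis $X_1,\dots,X_m$ of $V_1$; $X_iu(g)=\lim_{\alpha\to0}\frac{u(g\exp(\alpha X_i))-u(g)}{\alpha}$, and $\mathbb{X}u(g)=\sum_{i=1}^m(X_iu(g))X_i\in V_1$ is the horizontal gradient; $\mathbb{X}c(g,v)$ denotes the horizontal gradient of $c(\cdot,v)$ at $g$. $\Gamma^1$ is the class of functions with continuous derivatives along $X_1,\dots,X_m$; $\Gamma^{1,1}_{\rm loc}$ is the class of functions in $\Gamma^1$ whose horizontal derivatives $X_if$ are locally Lipschitz with respect to $d$. The horizontal plane at $g$ is $H_g=\{gh:\ h\in\exp(V_1)\}$. A set $A\subset\mathbf{G}$ is H--convex if $g\delta_\lambda(g^{-1}g')\in A$ for every $g\in A$, $g'\in H_g\cap A$, $\lambda\in[0,1]$. A proper function $u:\Omega\to(-\infty,+\infty]$ (i.e. $u\not\equiv+\infty$) is $c$ H--convex if for every $g\in\Omega$ the set $\mathcal{P}_g=\{(v,\alpha)\in V_1\times\mathbb{R}:\ c(g',v)+\alpha\le u(g')\ \forall g'\in H_g\cap\Omega\}$ is nonempty and $u(g)=\sup_{(v,\alpha)\in\mathcal{P}_g}(c(g,v)+\alpha)$. For an H--convex set $A$, a function $u:A\to(-\infty,+\infty]$ is H--semiconvex if there is a constant $\ell>0$ with $u(g\delta_\lambda(g^{-1}g'))\le(1-\lambda)u(g)+\lambda u(g')+\ell\lambda(1-\lambda)\|\xi_1(g^{-1}g')\|^2$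 for all $g\in A$, $g'\in H_g\cap A$, $\lambda\in[0,1]$. A function $u$ on $\Omega$ is locally H--semiconvex in $\Omega$ if, for every open ball $B\subset\Omega$, $u$ is H--semiconvex on $B$. *)

theory Defs
  imports "HOL-Analysis.Analysis" "HOL-Algebra.Group"
begin

primrec Ck :: "nat \<Rightarrow> ('a::euclidean_space \<Rightarrow> 'b::real_normed_vector) \<Rightarrow> bool" where
  "Ck 0 f \<longleftrightarrow> continuous_on UNIV f"
| "Ck (Suc k) f \<longleftrightarrow> (\<forall>x. f differentiable at x) \<and>
     (\<forall>v. Ck k (\<lambda>x. frechet_derivative f (at x) v))"

definition smooth :: "('a::euclidean_space \<Rightarrow> 'b::real_normed_vector) \<Rightarrow> bool" where
  "smooth f \<longleftrightarrow> (\<forall>k. Ck k f)"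

text \<open>
  The type \<open>'v\<close> is the Lie algebra, and its inner product is the fixed scalar product.
  The layers of the stratification are \<open>layer G 1, \<dots>, layer G (step G)\<close>.
\<close>

record ('g, 'v) carnot = "'g monoid" +
  lie_exp :: "'v \<Rightarrow> 'g"
  bracket :: "'v \<Rightarrow> 'v \<Rightarrow> 'v"
  layer :: "nat \<Rightarrow> 'v set"
  step :: nat

definition lie_log :: "('g, 'v, 'z) carnot_scheme \<Rightarrow> 'g \<Rightarrow> 'v" where
  "lie_log G g = inv_into UNIV (lie_exp G) g"

text \<open>
  The manifold structure of the group is the one for which \<open>lie_exp G\<close> is a diffeomorphism, so
  continuity and smoothness on the group are read in this global chart.
\<close>

definition continuous_on_group ::
    "('g, 'v::euclidean_space, 'z) carnot_scheme \<Rightarrow> ('g \<Rightarrow> real) \<Rightarrow> bool" where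
  "continuous_on_group G f \<longleftrightarrow> continuous_on UNIV (\<lambda>x. f (lie_exp G x))"

definition smooth_on_group ::
    "('g, 'v::euclidean_space, 'z) carnot_scheme \<Rightarrow> ('g \<Rightarrow> real) \<Rightarrow> bool" where
  "smooth_on_group G f \<longleftrightarrow> smooth (\<lambda>x. f (lie_exp G x))"

text \<open>The left-invariant vector field determined by \<open>X\<close>, as a derivation.\<close>

definition lie_deriv ::
    "('g, 'v::real_vector, 'z) carnot_scheme \<Rightarrow> 'v \<Rightarrow> ('g \<Rightarrow> real) \<Rightarrow> 'g \<Rightarrow> real" where
  "lie_deriv G X f g = deriv (\<lambda>t::real. f (g \<otimes>\<^bsub>G\<^esub> lie_exp G (t *\<^sub>R X))) 0"

text \<open>
  A Lie group whose exponential map is a global diffeomorphism. The type \<open>'v\<close> is identified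
  with the space of left-invariant vector fields through \<open>lie_deriv\<close>: by the one-parameter
  subgroup law \<open>lie_exp G\<close> is the exponential map, and the last assumption says that
  \<open>bracket G\<close> is the commutator of left-invariant vector fields. The group is diffeomorphic to
  a vector space, hence connected and simply connected.
\<close>

locale exponential_lie_group = group G
  for G :: "('g, 'v::euclidean_space, 'z) carnot_scheme" (structure) +
  assumes exp_bij: "bij_betw (lie_exp G) UNIV (carrier G)"
    and exp_one_parameter:
      "\<And>s t X. lie_exp G ((s + t) *\<^sub>R X) = lie_exp G (s *\<^sub>R X) \<otimes> lie_exp G (t *\<^sub>R X)"
    and mult_smooth:
      "smooth (\<lambda>(x, y). lie_log G (lie_exp G x \<otimes> lie_exp G y))"
    and inv_smooth: "smooth (\<lambda>x. lie_log G (inv (lie_exp G x)))"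
    and bracket_commutator:
      "\<And>X Y f g. smooth_on_group G f \<Longrightarrow> g \<in> carrier G \<Longrightarrow>
         lie_deriv G (bracket G X Y) f g =
           lie_deriv G X (lie_deriv G Y f) g - lie_deriv G Y (lie_deriv G X f) g"

definition layer_decomposition ::
    "('g, 'v::real_vector, 'z) carnot_scheme \<Rightarrow> 'v \<Rightarrow> (nat \<Rightarrow> 'v) \<Rightarrow> bool" where
  "layer_decomposition G x w \<longleftrightarrow>
     (\<forall>j\<in>{1..step G}. w j \<in> layer G j) \<and> (\<forall>j. j \<notin> {1..step G} \<longrightarrow> w j = 0) \<and>
     x = (\<Sum>j=1..step G. w j)"

text \<open>Nilpotency is a consequence of the stratification.\<close>

locale carnot_group = exponential_lie_group +
  assumes step_pos: "1 \<le> step G"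
    and layer_subspace: "\<And>j. j \<in> {1..step G} \<Longrightarrow> subspace (layer G j)"
    and layer_nontrivial: "\<And>j. j \<in> {1..step G} \<Longrightarrow> layer G j \<noteq> {0}"
    and direct_sum: "\<And>x. \<exists>!w. layer_decomposition G x w"
    and layer_orthogonal:
      "\<And>i j x y. i \<in> {1..step G} \<Longrightarrow> j \<in> {1..step G} \<Longrightarrow> i \<noteq> j \<Longrightarrow>
         x \<in> layer G i \<Longrightarrow> y \<in> layer G j \<Longrightarrow> x \<bullet> y = 0"
    and layer_generated:
      "\<And>j. 1 \<le> j \<Longrightarrow> j < step G \<Longrightarrow>
         span {bracket G x y | x y. x \<in> layer G 1 \<and> y \<in> layer G j} = layer G (Suc j)"
    and layer_last:
      "\<And>x y. x \<in> layer G 1 \<Longrightarrow> y \<in> layer G (step G) \<Longrightarrow> bracket G x y = 0"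

definition xi :: "('g, 'v::real_vector, 'z) carnot_scheme \<Rightarrow> nat \<Rightarrow> 'g \<Rightarrow> 'v" where
  "xi G j g = (THE w. layer_decomposition G (lie_log G g) w) j"

definition dilation :: "('g, 'v::real_vector, 'z) carnot_scheme \<Rightarrow> real \<Rightarrow> 'g \<Rightarrow> 'g" where
  "dilation G l g = lie_exp G (\<Sum>j=1..step G. l ^ j *\<^sub>R xi G j g)"

definition gauge_norm :: "('g, 'v::real_normed_vector, 'z) carnot_scheme \<Rightarrow> 'g \<Rightarrow> real" where
  "gauge_norm G g =
     (\<Sum>i=1..step G. norm (xi G i g) powr (2 * fact (step G) / real i)) powr (1 / (2 * fact (step G)))"

definition gauge_dist :: "('g, 'v::real_normed_vector, 'z) carnot_scheme \<Rightarrow> 'g \<Rightarrow> 'g \<Rightarrow> real" where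
  "gauge_dist G g g' = gauge_norm G (inv\<^bsub>G\<^esub> g \<otimes>\<^bsub>G\<^esub> g')"

definition gauge_ball :: "('g, 'v::real_normed_vector, 'z) carnot_scheme \<Rightarrow> 'g \<Rightarrow> real \<Rightarrow> 'g set" where
  "gauge_ball G g R = {g' \<in> carrier G. gauge_dist G g g' < R}"

definition gauge_balls :: "('g, 'v::real_normed_vector, 'z) carnot_scheme \<Rightarrow> 'g set set" where
  "gauge_balls G = {gauge_ball G g R | g R. g \<in> carrier G \<and> R > 0}"

definition orthonormal_frame ::
    "('g, 'v::real_inner, 'z) carnot_scheme \<Rightarrow> nat \<Rightarrow> (nat \<Rightarrow> 'v) \<Rightarrow> bool" where
  "orthonormal_frame G m X \<longleftrightarrow>
     (\<forall>i\<in>{1..m}. \<forall>j\<in>{1..m}. X i \<bullet> X j = (if i = j then 1 else 0)) \<and>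
     span (X ` {1..m}) = layer G 1"

definition horizontal_gradient ::
    "('g, 'v::real_vector, 'z) carnot_scheme \<Rightarrow> nat \<Rightarrow> (nat \<Rightarrow> 'v) \<Rightarrow> ('g \<Rightarrow> real) \<Rightarrow> 'g \<Rightarrow> 'v" where
  "horizontal_gradient G m X f g = (\<Sum>i=1..m. lie_deriv G (X i) f g *\<^sub>R X i)"

definition Gamma1 ::
    "('g, 'v::euclidean_space, 'z) carnot_scheme \<Rightarrow> nat \<Rightarrow> (nat \<Rightarrow> 'v) \<Rightarrow> ('g \<Rightarrow> real) set" where
  "Gamma1 G m X = {f. \<forall>i\<in>{1..m}.
     (\<forall>g\<in>carrier G. (\<lambda>t::real. f (g \<otimes>\<^bsub>G\<^esub> lie_exp G (t *\<^sub>R X i))) differentiable at 0) \<and>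
     continuous_on_group G (lie_deriv G (X i) f)}"

definition locally_lipschitz ::
    "('g, 'v::real_normed_vector, 'z) carnot_scheme \<Rightarrow> ('g \<Rightarrow> real) \<Rightarrow> bool" where
  "locally_lipschitz G f \<longleftrightarrow> (\<forall>g\<in>carrier G. \<exists>R>0. \<exists>L.
     \<forall>h\<in>gauge_ball G g R. \<forall>h'\<in>gauge_ball G g R. \<bar>f h - f h'\<bar> \<le> L * gauge_dist G h h')"

definition Gamma11_loc ::
    "('g, 'v::euclidean_space, 'z) carnot_scheme \<Rightarrow> nat \<Rightarrow> (nat \<Rightarrow> 'v) \<Rightarrow> ('g \<Rightarrow> real) set" where
  "Gamma11_loc G m X =
     {f \<in> Gamma1 G m X. \<forall>i\<in>{1..m}. locally_lipschitz G (lie_deriv G (X i) f)}"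

definition horizontal_plane :: "('g, 'v, 'z) carnot_scheme \<Rightarrow> 'g \<Rightarrow> 'g set" where
  "horizontal_plane G g = {g \<otimes>\<^bsub>G\<^esub> h | h. h \<in> lie_exp G ` layer G 1}"

definition H_segment ::
    "('g, 'v::real_vector, 'z) carnot_scheme \<Rightarrow> 'g \<Rightarrow> 'g \<Rightarrow> real \<Rightarrow> 'g" where
  "H_segment G g g' l = g \<otimes>\<^bsub>G\<^esub> dilation G l (inv\<^bsub>G\<^esub> g \<otimes>\<^bsub>G\<^esub> g')"

definition H_convex :: "('g, 'v::real_vector, 'z) carnot_scheme \<Rightarrow> 'g set \<Rightarrow> bool" where
  "H_convex G A \<longleftrightarrow> A \<subseteq> carrier G \<and>
     (\<forall>g\<in>A. \<forall>g'\<in>horizontal_plane G g \<inter> A. \<forall>l\<in>{0..1}. H_segment G g g' l \<in> A)"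

text \<open>
  Functions with values in \<open>(-\<infinity>, +\<infinity>]\<close> are \<open>ereal\<close>-valued functions that avoid
  \<open>-\<infinity>\<close> on the set under consideration.
\<close>

definition proper_on :: "'g set \<Rightarrow> ('g \<Rightarrow> ereal) \<Rightarrow> bool" where
  "proper_on \<Omega> u \<longleftrightarrow> (\<forall>g\<in>\<Omega>. u g \<noteq> -\<infinity>) \<and> (\<exists>g\<in>\<Omega>. u g \<noteq> \<infinity>)"

definition c_minorants ::
    "('g, 'v, 'z) carnot_scheme \<Rightarrow> ('g \<Rightarrow> 'v \<Rightarrow> real) \<Rightarrow> 'g set \<Rightarrow> ('g \<Rightarrow> ereal) \<Rightarrow> 'g \<Rightarrow> ('v \<times> real) set" where
  "c_minorants G c \<Omega> u g =
     {(v, \<alpha>). v \<in> layer G 1 \<and> (\<forall>g'\<in>horizontal_plane G g \<inter> \<Omega>. ereal (c g' v + \<alpha>) \<le> u g')}"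

definition c_H_convex ::
    "('g, 'v, 'z) carnot_scheme \<Rightarrow> ('g \<Rightarrow> 'v \<Rightarrow> real) \<Rightarrow> 'g set \<Rightarrow> ('g \<Rightarrow> ereal) \<Rightarrow> bool" where
  "c_H_convex G c \<Omega> u \<longleftrightarrow> proper_on \<Omega> u \<and>
     (\<forall>g\<in>\<Omega>. c_minorants G c \<Omega> u g \<noteq> {} \<and>
        u g = (SUP (v, \<alpha>)\<in>c_minorants G c \<Omega> u g. ereal (c g v + \<alpha>)))"

definition H_semiconvex_on ::
    "('g, 'v::real_normed_vector, 'z) carnot_scheme \<Rightarrow> 'g set \<Rightarrow> ('g \<Rightarrow> ereal) \<Rightarrow> bool" where
  "H_semiconvex_on G A u \<longleftrightarrow> H_convex G A \<and> (\<forall>g\<in>A. u g \<noteq> -\<infinity>) \<and>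
     (\<exists>K>0. \<forall>g\<in>A. \<forall>g'\<in>horizontal_plane G g \<inter> A. \<forall>l\<in>{0..1}.
        u (H_segment G g g' l) \<le>
          ereal (1 - l) * u g + ereal l * u g'
          + ereal (K * l * (1 - l) * (norm (xi G 1 (inv\<^bsub>G\<^esub> g \<otimes>\<^bsub>G\<^esub> g')))\<^sup>2))"

definition locally_H_semiconvex ::
    "('g, 'v::real_normed_vector, 'z) carnot_scheme \<Rightarrow> 'g set \<Rightarrow> ('g \<Rightarrow> ereal) \<Rightarrow> bool" where
  "locally_H_semiconvex G \<Omega> u \<longleftrightarrow>
     (\<forall>B\<in>gauge_balls G. B \<subseteq> \<Omega> \<longrightarrow> H_semiconvex_on G B u)"

end

theory Submission
  imports Defs
begin

text \<open>
  A supremum of functions that are semiconvex along a line with one common constant is again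
  semiconvex with that constant. Let \<open>h = H_segment G g g' l\<close>. The points \<open>g\<close> and \<open>g'\<close>
  lie in the horizontal plane of \<open>h\<close>, so every minorant \<open>c(\<cdot>, v) + \<alpha>\<close> in \<open>c_minorants\<close> at
  \<open>h\<close> is below \<open>\<psi>\<close> at \<open>g\<close> and at \<open>g'\<close>; hence it suffices that every \<open>c(\<cdot>, v)\<close> is semiconvex
  along horizontal segments in the ball, with a constant that does not depend on \<open>v\<close>. Along
  \<open>t \<mapsto> g exp(t y)\<close> with \<open>y\<close> in the first layer the gauge distance is \<open>\<bar>t - s\<bar> * norm y\<close>, so if
  the derivative of \<open>t \<mapsto> c(g exp(t y), v)\<close> is the inner product of the horizontal gradient with
  \<open>y\<close>, then it is Lipschitz with constant \<open>2 K \<parallel>y\<parallel>\<^sup>2\<close>, and adding \<open>K \<parallel>y\<parallel>\<^sup>2 t\<^sup>2\<close> makes the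
  function convex (\<open>semiconvex_of_derivative_bound\<close>).

  The substance is therefore \<open>horizontal_derivative\<close>: a function with continuous derivatives along
  \<open>X\<^sub>1, \<dots>, X\<^sub>m\<close> is differentiable along every combination of them, with the expected derivative.
  The hypotheses only control increments of \<open>f\<close> along the curves \<open>g exp(t X\<^sub>i)\<close>. A concatenation of
  such curves approximates \<open>g exp(t (x + y))\<close> but need not end on it, so continuity of \<open>f\<close> is needed,
  and this comes from the bracket-generating condition. The argument is carried out in
  exponential coordinates, where the group is a smooth associative operation \<open>\<star>\<close> on a Euclidean
  space whose lines through the origin are one-parameter subgroups (\<open>chart_group\<close>).

  \<^item> Continuity of \<open>f\<close> (\<open>continuous_of_bracket_generating\<close>). The elements \<open>a\<close> for which
    \<open>p \<mapsto> f (p \<star> a) - f p\<close> is continuous form a group containing all \<open>t X\<^sub>i\<close>. The span of the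
    vectors \<open>Ad a X\<^sub>i\<close> with \<open>a\<close> in that group is stable under \<open>Ad (t X\<^sub>i)\<close>, hence, by
    differentiating in \<open>t\<close>, under the bracket with \<open>X\<^sub>i\<close>; so it is the whole Lie algebra. A product
    of curves \<open>a \<star> t X\<^sub>i \<star> a\<^sup>-\<^sup>1\<close> then covers a neighbourhood of the identity, and \<open>f\<close> varies little
    along each of them: the increments for \<open>a\<close> and for \<open>a\<^sup>-\<^sup>1\<close> cancel in the limit.

  \<^item> Additivity (\<open>trotter_estimate\<close>, \<open>deriv_along_add\<close>). The powers of
    \<open>(x/n) \<star> (y/n)\<close> up to the \<open>n\<close>-th stay uniformly close to the line \<open>t (x + y)\<close>, and the \<open>n\<close>-th
    power tends to \<open>x + y\<close>. Along these powers the increments of \<open>f\<close> are controlled by its two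
    derivatives, and continuity of \<open>f\<close> transfers the estimate to the end point of the line.
\<close>

section \<open>Differential calculus in normed spaces\<close>

text \<open>
  The mean value theorem in the direction \<open>u\<close> turns the second difference into \<open>h\<close> times a first
  difference of \<open>x \<mapsto> f' x u\<close> near \<open>a\<close>, which \<open>L\<close> approximates up to \<open>o(h)\<close>.
\<close>

lemma second_difference_tendsto:
  fixes f :: "'a::real_normed_vector \<Rightarrow> real"
  assumes f: "\<And>x. (f has_derivative f' x) (at x)"
    and L: "((\<lambda>x. f' x u) has_derivative L) (at a)"
  shows "((\<lambda>h. (f (a + h *\<^sub>R u + h *\<^sub>R v) - f (a + h *\<^sub>R u) - f (a + h *\<^sub>R v) + f a) / h\<^sup>2)
    \<longlongrightarrow> L v) (at_right 0)"
proof (rule tendstoI)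
  fix e :: real
  assume e: "e > 0"
  \<comment> \<open>\<open>C h\<close> dominates the sum of the distances from \<open>a\<close> of the two points at which \<open>f'\<close> is compared; the summand 1 keeps \<open>C\<close> positive.\<close>
  define C where "C = 2 * norm u + norm v + 1"
  have C: "C > 0" by (simp add: C_def add_nonneg_pos)
  interpret L: bounded_linear L using L by (rule has_derivative_bounded_linear)
  obtain d where d: "d > 0" and approx: "\<And>y. norm (y - a) < d \<Longrightarrow>
      norm (f' y u - f' a u - L (y - a)) \<le> e / (2 * C) * norm (y - a)"
    using L e C unfolding has_derivative_at_alt by (metis divide_pos_pos mult_pos_pos zero_less_numeral)
  have "dist ((f (a + h *\<^sub>R u + h *\<^sub>R v) - f (a + h *\<^sub>R u) - f (a + h *\<^sub>R v) + f a) / h\<^sup>2) (L v) < e"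
    if h: "0 < h" "h < d / C" for h
  proof -
    have hC: "h * C < d" using h C by (simp add: field_simps)
    define g where "g s = f (a + s *\<^sub>R u + h *\<^sub>R v) - f (a + s *\<^sub>R u)" for s
    have fl: "((\<lambda>s. f (w + s *\<^sub>R u)) has_real_derivative f' (w + s *\<^sub>R u) u) (at s)" for w s
    proof -
      have "((\<lambda>s. f (w + s *\<^sub>R u)) has_derivative (\<lambda>t. f' (w + s *\<^sub>R u) (t *\<^sub>R u))) (at s)"
        by (rule has_derivative_compose[OF _ f]) (auto intro!: derivative_eq_intros)
      moreover have "f' (w + s *\<^sub>R u) (t *\<^sub>R u) = f' (w + s *\<^sub>R u) u * t" for t
        using has_derivative_bounded_linear[OF f] by (simp add: bounded_linear.linear linear_scale)
      ultimately show ?thesis by (simp add: has_field_derivative_def)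
    qed
    have "(g has_real_derivative (f' (a + s *\<^sub>R u + h *\<^sub>R v) u - f' (a + s *\<^sub>R u) u)) (at s)" for s
      unfolding g_def using DERIV_diff[OF fl[of "a + h *\<^sub>R v" s] fl[of a s]] by (simp add: algebra_simps)
    then obtain x where x: "0 < x" "x < h"
      and gx: "g h - g 0 = (h - 0) * (f' (a + x *\<^sub>R u + h *\<^sub>R v) u - f' (a + x *\<^sub>R u) u)"
      using MVT2[of 0 h g "\<lambda>s. f' (a + s *\<^sub>R u + h *\<^sub>R v) u - f' (a + s *\<^sub>R u) u"] h by auto
    have xu: "norm (x *\<^sub>R u) \<le> h * norm u" using x h by (simp add: mult_right_mono)
    have n1: "norm (x *\<^sub>R u + h *\<^sub>R v) \<le> h * (norm u + norm v)"
      using norm_triangle_ineq[of "x *\<^sub>R u" "h *\<^sub>R v"] xu h by (simp add: algebra_simps)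
    have hu: "h * (norm u + norm v) \<le> h * C" "h * norm u \<le> h * C"
      using h by (auto simp: C_def algebra_simps)
    have a1: "norm (f' (a + x *\<^sub>R u + h *\<^sub>R v) u - f' a u - L (x *\<^sub>R u + h *\<^sub>R v))
        \<le> e / (2 * C) * (h * (norm u + norm v))"
      using approx[of "a + x *\<^sub>R u + h *\<^sub>R v"] n1 hu hC e C
      by (smt (verit) add_diff_cancel_left' divide_pos_pos mult_left_mono add.assoc)
    have a2: "norm (f' (a + x *\<^sub>R u) u - f' a u - L (x *\<^sub>R u)) \<le> e / (2 * C) * (h * norm u)"
      using approx[of "a + x *\<^sub>R u"] xu hu hC e C
      by (smt (verit) add_diff_cancel_left' divide_pos_pos mult_left_mono)
    have "norm (f' (a + x *\<^sub>R u + h *\<^sub>R v) u - f' (a + x *\<^sub>R u) u - h * L v)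
        \<le> e / (2 * C) * (h * (norm u + norm v)) + e / (2 * C) * (h * norm u)"
    proof -
      have "f' (a + x *\<^sub>R u + h *\<^sub>R v) u - f' (a + x *\<^sub>R u) u - h * L v =
        (f' (a + x *\<^sub>R u + h *\<^sub>R v) u - f' a u - L (x *\<^sub>R u + h *\<^sub>R v)) -
        (f' (a + x *\<^sub>R u) u - f' a u - L (x *\<^sub>R u))"
        by (simp add: L.add L.scaleR)
      then show ?thesis using a1 a2 norm_triangle_ineq4 by (smt (verit))
    qed
    also have "\<dots> = e / (2 * C) * h * (2 * norm u + norm v)" using C by (simp add: field_simps)
    also have "\<dots> < e / (2 * C) * h * C"
      using e C h by (intro mult_strict_left_mono mult_pos_pos divide_pos_pos) (auto simp: C_def)
    also have "\<dots> \<le> e * h" using C e h by (simp add: field_simps)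
    finally have est: "\<bar>f' (a + x *\<^sub>R u + h *\<^sub>R v) u - f' (a + x *\<^sub>R u) u - h * L v\<bar> < e * h" by simp
    define E where "E = f' (a + x *\<^sub>R u + h *\<^sub>R v) u - f' (a + x *\<^sub>R u) u"
    have "f (a + h *\<^sub>R u + h *\<^sub>R v) - f (a + h *\<^sub>R u) - f (a + h *\<^sub>R v) + f a = h * E"
      using gx by (simp add: g_def E_def)
    moreover have "h * E / h\<^sup>2 - L v = (E - h * L v) / h"
      using h by (simp add: power2_eq_square field_simps)
    ultimately have "(f (a + h *\<^sub>R u + h *\<^sub>R v) - f (a + h *\<^sub>R u) - f (a + h *\<^sub>R v) + f a) / h\<^sup>2 - L v
      = (E - h * L v) / h"
      by simp
    moreover have "\<bar>(E - h * L v) / h\<bar> < e"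
      using est h by (simp add: E_def abs_divide pos_divide_less_eq)
    ultimately show ?thesis by (simp only: dist_real_def)
  qed
  then show "\<forall>\<^sub>F h in at_right 0. dist ((f (a + h *\<^sub>R u + h *\<^sub>R v) - f (a + h *\<^sub>R u) - f (a + h *\<^sub>R v) + f a) / h\<^sup>2) (L v) < e"
    using d C unfolding eventually_at_right_field by (meson divide_pos_pos)
qed

text \<open>
  The second difference quotient is symmetric in the two directions, so both iterated derivatives
  are its limit.
\<close>

lemma second_derivative_symmetric:
  fixes f :: "'a::real_normed_vector \<Rightarrow> 'b::euclidean_space"
  assumes f: "\<And>x. (f has_derivative f' x) (at x)"
    and A: "((\<lambda>x. f' x u) has_derivative A) (at a)"
    and B: "((\<lambda>x. f' x v) has_derivative B) (at a)"
  shows "A v = B u"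
proof (rule euclidean_eqI)
  fix b :: 'b
  define g where "g x = f x \<bullet> b" for x
  have g: "(g has_derivative (\<lambda>h. f' x h \<bullet> b)) (at x)" for x
    unfolding g_def by (rule has_derivative_inner_left[OF f])
  have "((\<lambda>h. (g (a + h *\<^sub>R u + h *\<^sub>R v) - g (a + h *\<^sub>R u) - g (a + h *\<^sub>R v) + g a) / h\<^sup>2)
    \<longlongrightarrow> A v \<bullet> b) (at_right 0)"
    by (rule second_difference_tendsto[OF g has_derivative_inner_left[OF A]])
  moreover have "((\<lambda>h. (g (a + h *\<^sub>R v + h *\<^sub>R u) - g (a + h *\<^sub>R v) - g (a + h *\<^sub>R u) + g a) / h\<^sup>2)
    \<longlongrightarrow> B u \<bullet> b) (at_right 0)"
    by (rule second_difference_tendsto[OF g has_derivative_inner_left[OF B]])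
  ultimately show "A v \<bullet> b = B u \<bullet> b"
    by (intro tendsto_unique[of "at_right (0::real)"]) (simp_all add: algebra_simps)
qed

lemma Ck_Suc_0_lipschitz_on_cball:
  fixes f :: "'a::euclidean_space \<Rightarrow> 'b::real_normed_vector"
  assumes f: "Ck (Suc 0) f"
  obtains C where "C \<ge> 0"
    "\<And>x y. norm x \<le> R \<Longrightarrow> norm y \<le> R \<Longrightarrow> norm (f x - f y) \<le> C * norm (x - y)"
proof -
  define D where "D x = frechet_derivative f (at x)" for x
  have D: "(f has_derivative D x) (at x)" for x
    using f by (simp add: D_def frechet_derivative_works[symmetric])
  have "\<exists>C. \<forall>x\<in>cball 0 R. norm (D x b) \<le> C" for b
  proof -
    have "continuous_on UNIV (\<lambda>x. D x b)" using f by (simp add: D_def)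
    then have "compact ((\<lambda>x. D x b) ` cball 0 R)"
      by (meson compact_cball compact_continuous_image continuous_on_subset subset_UNIV)
    then show ?thesis using compact_imp_bounded bounded_iff by (metis imageI)
  qed
  then obtain C where C: "\<And>b x. x \<in> cball 0 R \<Longrightarrow> norm (D x b) \<le> C b" by metis
  define K where "K = (\<Sum>b\<in>Basis. \<bar>C b\<bar>)"
  have "onorm (D x) \<le> K" if x: "x \<in> cball 0 R" for x
  proof (rule onorm_bound)
    show "0 \<le> K" by (simp add: K_def sum_nonneg)
    fix h
    interpret bounded_linear "D x" using D by (rule has_derivative_bounded_linear)
    have "D x h = (\<Sum>b\<in>Basis. (h \<bullet> b) *\<^sub>R D x b)"
      by (subst (1) euclidean_representation[of h, symmetric]) (simp add: sum scaleR)
    also have "norm \<dots> \<le> (\<Sum>b\<in>Basis. norm h * \<bar>C b\<bar>)"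
    proof (rule sum_norm_le)
      fix b :: 'a assume b: "b \<in> Basis"
      have "norm (D x b) \<le> \<bar>C b\<bar>" using C[OF x, of b] by linarith
      then show "norm ((h \<bullet> b) *\<^sub>R D x b) \<le> norm h * \<bar>C b\<bar>"
        using Basis_le_norm[OF b, of h] by (simp add: mult_mono)
    qed
    finally show "norm (D x h) \<le> K * norm h"
      by (simp add: K_def sum_distrib_left mult.commute)
  qed
  then have "norm (f x - f y) \<le> K * norm (x - y)" if "norm x \<le> R" "norm y \<le> R" for x y
    using that D differentiable_bound[of "cball 0 R" f D K x y]
    by (auto intro: has_derivative_at_withinI)
  moreover have "0 \<le> K" by (simp add: K_def sum_nonneg)
  ultimately show thesis using that by blast
qed

lemma has_vector_derivative_in_subspace:
  fixes v :: "real \<Rightarrow> 'a::euclidean_space"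
  assumes W: "subspace W" and v: "\<And>t. v t \<in> W"
    and d: "(v has_vector_derivative d) (at t)"
  shows "d \<in> W"
proof (rule Lim_in_closed_set)
  show "closed W" using W by (rule closed_subspace)
  show "((\<lambda>s. (v (t + s) - v t) /\<^sub>R s) \<longlongrightarrow> d) (at 0)"
  proof (rule tendsto_norm_zero_cancel[THEN Lim_null[THEN iffD2]])
    have "((\<lambda>s. norm (v (t + s) - v t - s *\<^sub>R d) / \<bar>s\<bar>) \<longlongrightarrow> 0) (at 0)"
      using d by (simp add: has_vector_derivative_def has_derivative_at)
    moreover have "\<forall>\<^sub>F s in at 0. norm (v (t + s) - v t - s *\<^sub>R d) / \<bar>s\<bar> =
        norm ((v (t + s) - v t) /\<^sub>R s - d)"
    proof (rule eventually_mono[OF eventually_neq_at_within[of 0]])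
      fix s :: real
      assume "s \<noteq> 0"
      then have "(v (t + s) - v t) /\<^sub>R s - d = (v (t + s) - v t - s *\<^sub>R d) /\<^sub>R s"
        by (simp add: scaleR_right_diff_distrib)
      then show "norm (v (t + s) - v t - s *\<^sub>R d) / \<bar>s\<bar> = norm ((v (t + s) - v t) /\<^sub>R s - d)"
        by (simp add: divide_inverse_commute)
    qed
    ultimately show "((\<lambda>s. norm ((v (t + s) - v t) /\<^sub>R s - d)) \<longlongrightarrow> 0) (at 0)"
      by (rule Lim_transform_eventually)
  qed
  show "\<forall>\<^sub>F s in at 0. (v (t + s) - v t) /\<^sub>R s \<in> W"
    using W v by (simp add: subspace_diff subspace_scale)
qed simp

section \<open>Groups in exponential coordinates\<close>

text \<open>
  The image of a Lie group under the logarithm. The law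
  \<open>(s + t) x = s x \<star> t x\<close> of one-parameter subgroups encodes that \<open>0\<close> is the identity and \<open>- x\<close> the inverse of \<open>x\<close>.
\<close>

locale chart_group =
  fixes mult :: "'v::euclidean_space \<Rightarrow> 'v \<Rightarrow> 'v" (infixl "\<star>" 70)
  assumes smooth_mult: "smooth (\<lambda>(x, y). x \<star> y)"
    and assoc: "x \<star> y \<star> z = x \<star> (y \<star> z)"
    and one_parameter: "(s + t) *\<^sub>R x = s *\<^sub>R x \<star> t *\<^sub>R x"
begin

lemma right_unit [simp]: "x \<star> 0 = x"
  using one_parameter[of 1 0 x] by simp

lemma left_unit [simp]: "0 \<star> x = x"
  using one_parameter[of 0 1 x] by simp

lemma right_inverse [simp]: "x \<star> - x = 0"
  using one_parameter[of 1 "- 1" x] by simp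

lemma left_inverse [simp]: "- x \<star> x = 0"
  using one_parameter[of "- 1" 1 x] by simp

lemma cancel_right [simp]: "x \<star> y \<star> - y = x" "x \<star> - y \<star> y = x"
  by (simp_all add: assoc)

lemma cancel_left [simp]: "x \<star> (- x \<star> y) = y" "- x \<star> (x \<star> y) = y"
  by (simp_all flip: assoc)

lemma minus_mult: "- (x \<star> y) = - y \<star> - x"
proof -
  have "- (x \<star> y) = - (x \<star> y) \<star> (x \<star> y \<star> (- y \<star> - x))"
    by (simp add: assoc)
  then show ?thesis by (simp only: cancel_left)
qed

definition Dmult :: "'v \<times> 'v \<Rightarrow> 'v \<times> 'v \<Rightarrow> 'v" where
  "Dmult p = frechet_derivative (\<lambda>(x, y). x \<star> y) (at p)"

text \<open>
  The second derivative of the multiplication at the identity \<open>(0, 0)\<close>; the vector \<open>u\<close> is the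
  direction of the inner derivative.
\<close>

definition D2mult :: "'v \<times> 'v \<Rightarrow> 'v \<times> 'v \<Rightarrow> 'v" where
  "D2mult u = frechet_derivative (\<lambda>p. Dmult p u) (at 0)"

lemma mult_has_derivative: "((\<lambda>(x, y). x \<star> y) has_derivative Dmult p) (at p)"
proof -
  have "Ck (Suc 0) (\<lambda>(x, y). x \<star> y)" using smooth_mult by (simp only: smooth_def)
  then show ?thesis
    by (simp add: Dmult_def frechet_derivative_works[symmetric] del: split_paired_All)
qed

lemma Dmult_has_derivative: "((\<lambda>p. Dmult p u) has_derivative D2mult u) (at 0)"
proof -
  have "Ck (Suc (Suc 0)) (\<lambda>(x, y). x \<star> y)" using smooth_mult by (simp only: smooth_def)
  then show ?thesis
    by (simp add: D2mult_def Dmult_def frechet_derivative_works[symmetric] del: split_paired_All)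
qed

lemma linear_Dmult: "linear (Dmult p)"
  using mult_has_derivative has_derivative_linear by blast

lemma linear_D2mult: "linear (D2mult u)"
  using Dmult_has_derivative has_derivative_linear by blast

lemma D2mult_symmetric: "D2mult u v = D2mult v u"
  by (rule second_derivative_symmetric[OF mult_has_derivative Dmult_has_derivative Dmult_has_derivative])

lemma has_derivative_mult:
  assumes f: "(f has_derivative f') (at x within T)" and g: "(g has_derivative g') (at x within T)"
  shows "((\<lambda>x. f x \<star> g x) has_derivative (\<lambda>h. Dmult (f x, g x) (f' h, g' h))) (at x within T)"
  using has_derivative_compose[OF has_derivative_Pair[OF f g] mult_has_derivative] by simp

lemma continuous_on_group_mult [continuous_intros]:
  assumes "continuous_on T f" "continuous_on T g"
  shows "continuous_on T (\<lambda>x. f x \<star> g x)"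
proof -
  have "continuous_on UNIV (\<lambda>(x, y). x \<star> y)"
    using mult_has_derivative has_derivative_continuous continuous_at_imp_continuous_on by blast
  from continuous_on_compose2[OF this continuous_on_Pair[OF assms]] show ?thesis by simp
qed

lemma Dmult_left_unit [simp]: "Dmult (0, y) (0, b) = b"
proof -
  have "((\<lambda>z. 0 \<star> z) has_derivative (\<lambda>h. Dmult (0, y) (0, h))) (at y)"
    by (rule has_derivative_mult) (auto intro!: derivative_eq_intros)
  then have "(\<lambda>h. Dmult (0, y) (0, h)) = (\<lambda>h. h)"
    using has_derivative_unique[OF _ has_derivative_ident] by simp
  then show ?thesis by metis
qed

lemma Dmult_right_unit [simp]: "Dmult (x, 0) (a, 0) = a"
proof -
  have "((\<lambda>z. z \<star> 0) has_derivative (\<lambda>h. Dmult (x, 0) (h, 0))) (at x)"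
    by (rule has_derivative_mult) (auto intro!: derivative_eq_intros)
  then have "(\<lambda>h. Dmult (x, 0) (h, 0)) = (\<lambda>h. h)"
    using has_derivative_unique[OF _ has_derivative_ident] by simp
  then show ?thesis by metis
qed

lemma Dmult_zero [simp]: "Dmult (0, 0) (a, b) = a + b"
proof -
  have "Dmult (0, 0) ((a, 0) + (0, b)) = a + b"
    unfolding linear_add[OF linear_Dmult] by simp
  then show ?thesis by simp
qed

lemma Dmult_along_line:
  "((\<lambda>t. Dmult (t *\<^sub>R x, t *\<^sub>R y) u) has_vector_derivative D2mult u (x, y)) (at 0)"
proof -
  have line: "((\<lambda>t. (t *\<^sub>R x, t *\<^sub>R y)) has_derivative (\<lambda>t. (t *\<^sub>R x, t *\<^sub>R y))) (at (0::real))"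
    by (auto intro!: derivative_eq_intros)
  have "((\<lambda>p. Dmult p u) has_derivative D2mult u) (at (0 *\<^sub>R x, 0 *\<^sub>R y))"
    using Dmult_has_derivative by (simp add: zero_prod_def)
  from has_derivative_compose[OF line this]
  have "((\<lambda>t. Dmult (t *\<^sub>R x, t *\<^sub>R y) u) has_derivative (\<lambda>t. D2mult u (t *\<^sub>R x, t *\<^sub>R y))) (at (0::real))" .
  moreover have "D2mult u (t *\<^sub>R x, t *\<^sub>R y) = t *\<^sub>R D2mult u (x, y)" for t
    using linear_scale[OF linear_D2mult, of u t "(x, y)"] by simp
  ultimately show ?thesis by (simp add: has_vector_derivative_def)
qed

lemma D2mult_left_left [simp]: "D2mult (a, 0) (x, 0) = 0"
proof (rule vector_derivative_unique_at)
  show "((\<lambda>t. Dmult (t *\<^sub>R x, t *\<^sub>R 0) (a, 0)) has_vector_derivative D2mult (a, 0) (x, 0)) (at 0)"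
    by (rule Dmult_along_line)
  show "((\<lambda>t::real. Dmult (t *\<^sub>R x, t *\<^sub>R 0) (a, 0)) has_vector_derivative 0) (at 0)"
    by simp
qed

end

section \<open>The adjoint action and the bracket\<close>

context chart_group
begin

text \<open>
  The derivative at the identity of the conjugation \<open>x \<mapsto> a \<star> x \<star> - a\<close>, spelled out by the chain
  rule so that it can be differentiated in \<open>a\<close>.
\<close>

definition Ad :: "'v \<Rightarrow> 'v \<Rightarrow> 'v" where
  "Ad a z = Dmult (a, - a) (Dmult (a, 0) (0, z), 0)"

lemma conj_has_derivative: "((\<lambda>x. a \<star> x \<star> - a) has_derivative Ad a) (at 0)"
proof -
  have "((\<lambda>x. a \<star> x) has_derivative (\<lambda>h. Dmult (a, 0) (0, h))) (at 0)"
    by (rule has_derivative_mult) (auto intro!: derivative_eq_intros)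
  then have "((\<lambda>x. a \<star> x \<star> - a) has_derivative (\<lambda>h. Dmult (a \<star> 0, - a) (Dmult (a, 0) (0, h), 0))) (at 0)"
    by (rule has_derivative_mult) (auto intro!: derivative_eq_intros)
  then show ?thesis by (simp add: Ad_def[abs_def])
qed

lemma linear_Ad: "linear (Ad a)"
  using conj_has_derivative has_derivative_linear by blast

lemma Ad_0 [simp]: "Ad 0 z = z"
  by (simp add: Ad_def)

lemma Ad_mult: "Ad (a \<star> b) z = Ad a (Ad b z)"
proof -
  have "((\<lambda>x. a \<star> (b \<star> x \<star> - b) \<star> - a) has_derivative (\<lambda>h. Ad a (Ad b h))) (at 0)"
    by (rule has_derivative_compose[OF conj_has_derivative[of b]]) (simp add: conj_has_derivative)
  moreover have "(\<lambda>x. a \<star> (b \<star> x \<star> - b) \<star> - a) = (\<lambda>x. a \<star> b \<star> x \<star> - (a \<star> b))"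
    by (simp add: minus_mult assoc)
  ultimately have "(\<lambda>h. Ad a (Ad b h)) = Ad (a \<star> b)"
    using conj_has_derivative has_derivative_unique by metis
  then show ?thesis by metis
qed

text \<open>
  The antisymmetric part of the mixed second derivative of the multiplication. It is the commutator
  of the left-invariant vector fields at the identity.
\<close>

definition chart_bracket :: "'v \<Rightarrow> 'v \<Rightarrow> 'v" where
  "chart_bracket x y = D2mult (0, y) (x, 0) - D2mult (0, x) (y, 0)"

lemma linear_chart_bracket_left: "linear (\<lambda>x. chart_bracket x y)"
proof (rule linearI)
  note linear_simps = linear_add[OF linear_D2mult] linear_scale[OF linear_D2mult]
  show "chart_bracket (a + b) y = chart_bracket a y + chart_bracket b y" for a b
    using linear_simps(1)[of "(0, y)" "(a, 0)" "(b, 0)"] linear_simps(1)[of "(y, 0)" "(0, a)" "(0, b)"]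
    by (simp add: chart_bracket_def D2mult_symmetric[of "(0, _)" "(y, 0)"])
  show "chart_bracket (r *\<^sub>R a) y = r *\<^sub>R chart_bracket a y" for r a
    using linear_simps(2)[of "(0, y)" r "(a, 0)"] linear_simps(2)[of "(y, 0)" r "(0, a)"]
    by (simp add: chart_bracket_def D2mult_symmetric[of "(0, _)" "(y, 0)"] scaleR_right_diff_distrib)
qed

text \<open>
  The identity \<open>d/dt Ad (exp (t x)) z = [x, z]\<close>. Both factors of \<open>Ad\<close> depend on \<open>t\<close>: the inner one
  contributes the first half of the bracket, and the outer one contributes the second half after
  exchanging the order of differentiation.
\<close>

lemma Ad_has_vector_derivative:
  "((\<lambda>t. Ad (t *\<^sub>R x) z) has_vector_derivative chart_bracket x z) (at 0)"
proof -
  define v where "v t = Dmult (t *\<^sub>R x, 0) (0, z)" for t :: real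
  have v0 [simp]: "v 0 = z" by (simp add: v_def)
  have v: "(v has_vector_derivative D2mult (0, z) (x, 0)) (at 0)"
    using Dmult_along_line[of x 0 "(0, z)"] by (simp add: v_def[abs_def])
  have expand: "w = (\<Sum>b\<in>Basis. (w \<bullet> b) *\<^sub>R b)" for w :: 'v
    by (simp add: euclidean_representation)
  have lin: "linear (\<lambda>w. Dmult p (w, 0))" for p
    using linear_compose[OF _ linear_Dmult, of "\<lambda>w. (w, 0)" p]
    by (simp add: o_def linear_iff)
  have lin2: "linear (\<lambda>w. D2mult (0, x) (w, 0))"
    using linear_compose[OF _ linear_D2mult, of "\<lambda>w. (w, 0)"]
    by (simp add: o_def linear_iff)
  have Ad: "Ad (t *\<^sub>R x) z = (\<Sum>b\<in>Basis. (v t \<bullet> b) *\<^sub>R Dmult (t *\<^sub>R x, t *\<^sub>R (- x)) (b, 0))" for t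
    unfolding Ad_def v_def[symmetric]
    by (subst expand[of "v t"]) (simp add: linear_sum[OF lin] linear_scale[OF lin])
  have D: "D2mult (b, 0) (x, - x) = - D2mult (0, x) (b, 0)" for b
    using linear_diff[OF linear_D2mult, of "(b, 0)" "(x, 0)" "(0, x)"]
    by (simp add: D2mult_symmetric[of "(0, x)" "(b, 0)"])
  have "((\<lambda>t. (v t \<bullet> b) *\<^sub>R Dmult (t *\<^sub>R x, t *\<^sub>R (- x)) (b, 0)) has_vector_derivative
      ((D2mult (0, z) (x, 0) \<bullet> b) *\<^sub>R b - (z \<bullet> b) *\<^sub>R D2mult (0, x) (b, 0))) (at 0)" for b
  proof -
    have "((\<lambda>t. v t \<bullet> b) has_vector_derivative D2mult (0, z) (x, 0) \<bullet> b) (at 0)"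
      using v by (rule bounded_linear.has_vector_derivative[OF bounded_linear_inner_left])
    then have vb: "((\<lambda>t. v t \<bullet> b) has_real_derivative D2mult (0, z) (x, 0) \<bullet> b) (at 0)"
      by (simp add: has_real_derivative_iff_has_vector_derivative)
    show ?thesis
      using has_vector_derivative_scaleR[OF vb Dmult_along_line[of x "- x" "(b, 0)"]]
      by (simp add: D)
  qed
  then have "((\<lambda>t. Ad (t *\<^sub>R x) z) has_vector_derivative
      (\<Sum>b\<in>Basis. (D2mult (0, z) (x, 0) \<bullet> b) *\<^sub>R b - (z \<bullet> b) *\<^sub>R D2mult (0, x) (b, 0))) (at 0)"
    unfolding Ad by (intro has_vector_derivative_sum) auto
  moreover have "D2mult (0, x) (z, 0) = (\<Sum>b\<in>Basis. (z \<bullet> b) *\<^sub>R D2mult (0, x) (b, 0))"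
    by (subst (1) expand[of z]) (simp add: linear_sum[OF lin2] linear_scale[OF lin2])
  ultimately show ?thesis
    by (simp add: chart_bracket_def sum_subtractf euclidean_representation)
qed

end

section \<open>Functions with continuous derivatives along a one-parameter subgroup\<close>

context chart_group
begin

text \<open>
  The function \<open>D\<close> is the derivative of \<open>f\<close> along the left-invariant vector field of \<open>x\<close>. Continuity
  of \<open>f\<close> itself has to be derived from a bracket-generating set of such directions.
\<close>

definition deriv_along :: "('v \<Rightarrow> real) \<Rightarrow> 'v \<Rightarrow> ('v \<Rightarrow> real) \<Rightarrow> bool" where
  "deriv_along f x D \<longleftrightarrow> continuous_on UNIV D \<and>
     (\<forall>p. ((\<lambda>t. f (p \<star> t *\<^sub>R x)) has_real_derivative D p) (at 0))"

lemma deriv_along_line: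
  assumes "deriv_along f x D"
  shows "((\<lambda>t. f (p \<star> t *\<^sub>R x)) has_real_derivative D (p \<star> t *\<^sub>R x)) (at t)"
proof -
  have eq: "p \<star> s *\<^sub>R x = p \<star> t *\<^sub>R x \<star> (s - t) *\<^sub>R x" for s
    using one_parameter[of t "s - t" x] by (simp add: assoc)
  have "((\<lambda>s. f (p \<star> t *\<^sub>R x \<star> s *\<^sub>R x)) has_real_derivative D (p \<star> t *\<^sub>R x)) (at (t - t))"
    using assms by (simp add: deriv_along_def)
  moreover have "((\<lambda>s. s - t) has_real_derivative 1) (at t)"
    by (auto intro!: derivative_eq_intros)
  ultimately have "((\<lambda>s. f (p \<star> t *\<^sub>R x \<star> (s - t) *\<^sub>R x)) has_real_derivative D (p \<star> t *\<^sub>R x) * 1) (at t)"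
    by (rule DERIV_chain2)
  then show ?thesis by (simp add: eq[symmetric])
qed

lemma deriv_along_scale:
  assumes "deriv_along f x D"
  shows "deriv_along f (r *\<^sub>R x) (\<lambda>p. r * D p)"
  unfolding deriv_along_def
proof (intro conjI allI)
  show "continuous_on UNIV (\<lambda>p. r * D p)"
    using assms by (auto simp: deriv_along_def intro!: continuous_intros)
  fix p
  have "((\<lambda>s. f (p \<star> s *\<^sub>R x)) has_real_derivative D p) (at (0 * r))"
    using assms by (simp add: deriv_along_def)
  moreover have "((\<lambda>s. s * r) has_real_derivative r) (at 0)"
    by (auto intro!: derivative_eq_intros)
  ultimately have "((\<lambda>s. f (p \<star> (s * r) *\<^sub>R x)) has_real_derivative D p * r) (at 0)"
    by (rule DERIV_chain2)
  then show "((\<lambda>t. f (p \<star> t *\<^sub>R r *\<^sub>R x)) has_real_derivative r * D p) (at 0)"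
    by (simp add: mult.commute)
qed

text \<open>
  The average of the derivative over the segment from \<open>p\<close> to \<open>p \<star> t x\<close>. In contrast to the
  difference quotient it is visibly continuous in \<open>p\<close> and \<open>t\<close> jointly, also at \<open>t = 0\<close>.
\<close>

definition mean_slope :: "('v \<Rightarrow> real) \<Rightarrow> 'v \<Rightarrow> 'v \<Rightarrow> real \<Rightarrow> real" where
  "mean_slope D x p t = integral {0..1} (\<lambda>s. D (p \<star> (s * t) *\<^sub>R x))"

lemma mean_slope_0 [simp]: "mean_slope D x p 0 = D p"
  by (simp add: mean_slope_def)

lemma continuous_on_mean_slope:
  assumes D: "continuous_on UNIV D" and f: "continuous_on T f" and g: "continuous_on T g"
  shows "continuous_on T (\<lambda>z. mean_slope D x (f z) (g z))"
proof -
  have "continuous_on (UNIV \<times> cbox 0 1) (\<lambda>(q, s). D (fst q \<star> (s * snd q) *\<^sub>R x))"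
    unfolding case_prod_beta by (intro continuous_on_compose2[OF D] continuous_intros) auto
  from integral_continuous_on_param[OF this]
  have "continuous_on UNIV (\<lambda>q. mean_slope D x (fst q) (snd q))"
    by (simp add: mean_slope_def)
  from continuous_on_compose2[OF this continuous_on_Pair[OF f g]] show ?thesis by simp
qed

lemma increment_eq_mean_slope:
  assumes f: "deriv_along f x D"
  shows "f (p \<star> t *\<^sub>R x) - f p = t * mean_slope D x p t"
proof -
  have "((\<lambda>s. f (p \<star> s *\<^sub>R t *\<^sub>R x)) has_vector_derivative t * D (p \<star> (s * t) *\<^sub>R x)) (at s within {0..1})" for s
    using deriv_along_line[OF deriv_along_scale[OF f, of t], of p s]
    by (auto simp: has_real_derivative_iff_has_vector_derivative intro: has_vector_derivative_at_within)
  then have "((\<lambda>s. t * D (p \<star> (s * t) *\<^sub>R x)) has_integral (f (p \<star> 1 *\<^sub>R t *\<^sub>R x) - f (p \<star> 0 *\<^sub>R t *\<^sub>R x))) {0..1}"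
    by (intro fundamental_theorem_of_calculus) auto
  from integral_unique[OF this] show ?thesis by (simp add: mean_slope_def)
qed

end

section \<open>Continuity from bracket-generating directions\<close>

context chart_group
begin

text \<open>
  A substitute for the subgroup generated by the directions of differentiability: it contains that
  subgroup, and it has the one property of its elements that matters.
\<close>

definition continuous_increments :: "('v \<Rightarrow> real) \<Rightarrow> 'v set" where
  "continuous_increments f = {a. continuous_on UNIV (\<lambda>p. f (p \<star> a) - f p)}"

lemma continuous_increment_compose:
  assumes "a \<in> continuous_increments f" "continuous_on T g"
  shows "continuous_on T (\<lambda>z. f (g z \<star> a) - f (g z))"
  using assms continuous_on_compose2[of UNIV "\<lambda>p. f (p \<star> a) - f p" T g]
  by (simp add: continuous_increments_def)

lemma continuous_increments_mult:
  assumes "a \<in> continuous_increments f" "b \<in> continuous_increments f"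
  shows "a \<star> b \<in> continuous_increments f"
proof -
  have "continuous_on UNIV (\<lambda>p. (f (p \<star> a \<star> b) - f (p \<star> a)) + (f (p \<star> a) - f p))"
    by (intro continuous_on_add continuous_increment_compose assms continuous_on_group_mult
        continuous_on_id continuous_on_const)
  then show ?thesis by (simp add: continuous_increments_def assoc)
qed

lemma continuous_increments_line:
  assumes "deriv_along f x D"
  shows "t *\<^sub>R x \<in> continuous_increments f"
  unfolding continuous_increments_def mem_Collect_eq increment_eq_mean_slope[OF assms]
  using assms by (intro continuous_intros continuous_on_mean_slope) (auto simp: deriv_along_def)

text \<open>
  Displacements by \<open>w x\<close> change \<open>f\<close> by an amount that is small for small \<open>x\<close>, locally uniformly in
  the base point. Joint continuity in the base point is what makes this stable under products.
\<close>

definition tame :: "('v \<Rightarrow> real) \<Rightarrow> ('v \<Rightarrow> 'v) \<Rightarrow> bool" where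
  "tame f w \<longleftrightarrow> w 0 = 0 \<and> continuous_on UNIV w \<and>
     continuous_on UNIV (\<lambda>(q, x). f (q \<star> w x) - f q)"

lemma tame_mult:
  assumes v: "tame f v" and w: "tame f w"
  shows "tame f (\<lambda>x. v x \<star> w x)"
proof -
  have 1: "continuous_on UNIV (\<lambda>z. f (fst z \<star> v (snd z)) - f (fst z))"
    using v by (simp add: tame_def case_prod_beta)
  have cv: "continuous_on UNIV (\<lambda>z::'v \<times> 'v. v (snd z))"
    using continuous_on_compose2[of UNIV v UNIV snd] v by (simp add: tame_def continuous_on_snd)
  have Hw: "continuous_on UNIV (\<lambda>z. f (fst z \<star> w (snd z)) - f (fst z))"
    using w by (simp add: tame_def case_prod_beta)
  have shift: "continuous_on UNIV (\<lambda>z. (fst z \<star> v (snd z), snd z))"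
    by (intro continuous_on_Pair continuous_on_group_mult continuous_on_fst continuous_on_snd
        continuous_on_id cv)
  have 2: "continuous_on UNIV (\<lambda>z. f (fst z \<star> v (snd z) \<star> w (snd z)) - f (fst z \<star> v (snd z)))"
    using continuous_on_compose2[OF Hw shift] by simp
  have "continuous_on UNIV (\<lambda>z. f (fst z \<star> (v (snd z) \<star> w (snd z))) - f (fst z))"
    using continuous_on_add[OF 2 1] by (simp add: assoc)
  moreover have "continuous_on UNIV (\<lambda>x. v x \<star> w x)" "v 0 \<star> w 0 = 0"
    using v w by (simp_all add: tame_def continuous_on_group_mult)
  ultimately show ?thesis by (simp add: tame_def case_prod_beta)
qed

text \<open>
  Going along \<open>a\<close>, then a short way along \<open>x\<close>, then back along \<open>- a\<close>: the increments of the
  first and the last part are values of one continuous function at nearby points, with opposite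
  signs.
\<close>

lemma tame_conj_line:
  assumes f: "deriv_along f x D" and a: "a \<in> continuous_increments f"
    and c: "continuous_on UNIV c" "c 0 = 0"
  shows "tame f (\<lambda>y. a \<star> c y *\<^sub>R x \<star> - a)"
proof -
  define w where "w y = a \<star> c y *\<^sub>R x \<star> - a" for y
  have D: "continuous_on UNIV D" using f by (simp add: deriv_along_def)
  have cw: "continuous_on UNIV w"
    unfolding w_def by (intro continuous_intros c)
  have c2: "continuous_on UNIV (\<lambda>z::'v \<times> 'v. c (snd z))" and w2: "continuous_on UNIV (\<lambda>z::'v \<times> 'v. w (snd z))"
    using continuous_on_compose2[OF c(1) continuous_on_snd[OF continuous_on_id], of UNIV]
      continuous_on_compose2[OF cw continuous_on_snd[OF continuous_on_id], of UNIV] by simp_all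
  have eq: "f (q \<star> w y) - f q = (f (q \<star> a) - f q) + c y * mean_slope D x (q \<star> a) (c y)
      - (f (q \<star> w y \<star> a) - f (q \<star> w y))" for q y
  proof -
    have "q \<star> w y \<star> a = q \<star> a \<star> c y *\<^sub>R x"
      by (simp add: w_def assoc)
    then show ?thesis using increment_eq_mean_slope[OF f, of "q \<star> a" "c y"] by simp
  qed
  have "continuous_on UNIV (\<lambda>z. (f (fst z \<star> a) - f (fst z)) + c (snd z) * mean_slope D x (fst z \<star> a) (c (snd z))
      - (f (fst z \<star> w (snd z) \<star> a) - f (fst z \<star> w (snd z))))"
    by (intro continuous_increment_compose[OF a] continuous_on_add continuous_on_diff
        continuous_on_mult continuous_on_mean_slope[OF D] continuous_on_group_mult
        continuous_on_fst continuous_on_id continuous_on_const c2 w2)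
  then have "continuous_on UNIV (\<lambda>(q, y). f (q \<star> w y) - f q)"
    unfolding case_prod_beta eq .
  then show ?thesis using cw c(2) by (simp add: tame_def w_def)
qed

text \<open>
  If the vectors \<open>Ad a x\<close> contain a basis, the product of the corresponding curves, with
  the coordinates as parameters, is a tame map with derivative the identity at \<open>0\<close>. It therefore
  maps each neighbourhood of \<open>0\<close> onto a neighbourhood of \<open>0\<close>.
\<close>

lemma continuous_of_Ad_span:
  assumes f: "\<And>x. x \<in> S \<Longrightarrow> deriv_along f x (D x)"
    and span: "span {Ad a x | a x. a \<in> continuous_increments f \<and> x \<in> S} = UNIV"
  shows "continuous_on UNIV f"
proof -
  define Q where "Q = {Ad a x | a x. a \<in> continuous_increments f \<and> x \<in> S}"
  obtain B where B: "B \<subseteq> Q" and indep: "independent B" and "Q \<subseteq> span B"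
    by (rule maximal_independent_subset)
  then have spanB: "span B = UNIV"
    using span_minimal[OF _ subspace_span, of Q B] span by (simp add: Q_def top.extremum_unique)
  have finB: "finite B" using indep by (rule independent_imp_finite)
  have "\<forall>b\<in>B. \<exists>a x. b = Ad a x \<and> a \<in> continuous_increments f \<and> x \<in> S"
    using B by (auto simp: Q_def)
  then obtain a x where ax: "\<And>b. b \<in> B \<Longrightarrow> b = Ad (a b) (x b)"
    "\<And>b. b \<in> B \<Longrightarrow> a b \<in> continuous_increments f" "\<And>b. b \<in> B \<Longrightarrow> x b \<in> S"
    by metis
  define c where "c b y = representation B y b" for b y
  have lin_c: "linear (c b)" for b
    unfolding c_def using indep spanB
    by (auto intro!: linearI simp: representation_add representation_scale)
  have "\<exists>w. tame f w \<and> (w has_derivative (\<lambda>y. \<Sum>b\<in>T. c b y *\<^sub>R b)) (at 0)" if "T \<subseteq> B" for T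
    using finite_subset[OF that finB] that
  proof (induction T rule: finite_induct)
    case empty
    show ?case
      by (rule exI[of _ "\<lambda>_. 0"]) (auto simp: tame_def)
  next
    case (insert b T)
    then obtain w where w: "tame f w" "(w has_derivative (\<lambda>y. \<Sum>b\<in>T. c b y *\<^sub>R b)) (at 0)" by auto
    have b: "b \<in> B" using insert by simp
    define v where "v y = a b \<star> c b y *\<^sub>R x b \<star> - a b" for y
    have v: "tame f v"
      unfolding v_def using f ax b lin_c
      by (intro tame_conj_line) (auto simp: linear_0 linear_continuous_on linear_conv_bounded_linear)
    have lin: "linear (\<lambda>y. c b y *\<^sub>R x b)"
      using lin_c[of b] by (simp add: linear_iff scaleR_add_left)
    have "((\<lambda>y. a b \<star> y \<star> - a b) has_derivative Ad (a b)) (at (c b 0 *\<^sub>R x b))"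
      using conj_has_derivative linear_0[OF lin_c] by simp
    from has_derivative_compose[OF linear_imp_has_derivative[OF lin] this]
    have "(v has_derivative (\<lambda>y. Ad (a b) (c b y *\<^sub>R x b))) (at 0)"
      by (simp add: v_def[abs_def])
    then have "(v has_derivative (\<lambda>y. c b y *\<^sub>R b)) (at 0)"
      using ax(1)[OF b] by (simp add: linear_scale[OF linear_Ad])
    from has_derivative_mult[OF this w(2)]
    have "((\<lambda>y. v y \<star> w y) has_derivative (\<lambda>y. \<Sum>b\<in>insert b T. c b y *\<^sub>R b)) (at 0)"
      using v w insert.hyps by (simp add: tame_def)
    then show ?case using tame_mult[OF v w(1)] by blast
  qed
  from this[of B] obtain w where w: "tame f w"
    and dw: "(w has_derivative (\<lambda>y. \<Sum>b\<in>B. c b y *\<^sub>R b)) (at 0)" by auto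
  have "(\<Sum>b\<in>B. c b y *\<^sub>R b) = y" for y
    unfolding c_def using indep spanB finB by (intro sum_representation_eq) auto
  then have dw: "(w has_derivative id) (at 0)"
    using dw by (simp add: id_def)
  have w0: "w 0 = 0" and cw: "continuous_on UNIV w" using w by (auto simp: tame_def)
  have "isCont f p" for p
    unfolding continuous_at_eps_delta
  proof (intro allI impI)
    fix e :: real
    assume e: "e > 0"
    have "continuous_on UNIV (\<lambda>(q, x). f (q \<star> w x) - f q)"
      using w by (simp add: tame_def)
    from continuous_on_compose2[OF this, of UNIV "\<lambda>x. (p, x)"]
    have "isCont (\<lambda>x. f (p \<star> w x) - f p) 0"
      by (simp add: continuous_on_eq_continuous_at continuous_on_Pair)
    then obtain d where d: "d > 0" "\<And>x. dist x 0 < d \<Longrightarrow> dist (f (p \<star> w x) - f p) (f (p \<star> w 0) - f p) < e"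
      using e unfolding continuous_at_eps_delta by blast
    have "w 0 \<in> interior (w ` ball 0 d)"
      by (rule sussmann_open_mapping[OF open_UNIV cw _ dw bounded_linear_ident, of "ball 0 d"])
        (use d in auto)
    then obtain r where r: "r > 0" "ball 0 r \<subseteq> w ` ball 0 d"
      by (auto simp: mem_interior w0)
    have "isCont (\<lambda>q. - p \<star> q) p"
      using continuous_on_group_mult[OF continuous_on_const continuous_on_id, of UNIV "- p"]
      by (simp add: continuous_on_eq_continuous_at)
    then obtain k where k: "k > 0" "\<And>q. dist q p < k \<Longrightarrow> dist (- p \<star> q) (- p \<star> p) < r"
      using r(1) unfolding continuous_at_eps_delta by blast
    have "dist (f q) (f p) < e" if q: "dist q p < k" for q
    proof -
      have "- p \<star> q \<in> ball 0 r" using k(2)[OF q] by (simp add: dist_commute)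
      then obtain y where y: "y \<in> ball 0 d" "- p \<star> q = w y" using r(2) by blast
      then have "q = p \<star> w y" by (metis cancel_left(1))
      then show ?thesis using d(2)[of y] y(1) by (simp add: w0 dist_real_def)
    qed
    then show "\<exists>d>0. \<forall>x'. dist x' p < d \<longrightarrow> dist (f x') (f p) < e" using k(1) by blast
  qed
  then show ?thesis by (simp add: continuous_on_eq_continuous_at)
qed

text \<open>
  Iterated brackets with elements of \<open>S\<close> on the left span the Lie algebra, phrased as an induction
  principle for subspaces.
\<close>

definition bracket_generating :: "'v set \<Rightarrow> bool" where
  "bracket_generating S \<longleftrightarrow> (\<forall>W. subspace W \<longrightarrow> S \<subseteq> W \<longrightarrow>
     (\<forall>x\<in>S. \<forall>z\<in>W. chart_bracket x z \<in> W) \<longrightarrow> W = UNIV)"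

text \<open>
  The span of all \<open>Ad a x\<close> is stable under \<open>Ad (t x)\<close> because the elements \<open>a\<close> form a group;
  differentiating at \<open>t = 0\<close> inside this closed subspace gives stability under the bracket.
\<close>

lemma continuous_of_bracket_generating:
  assumes gen: "bracket_generating S"
    and f: "\<And>x. x \<in> S \<Longrightarrow> deriv_along f x (D x)"
  shows "continuous_on UNIV f"
proof (rule continuous_of_Ad_span[OF f])
  define Q where "Q = {Ad a x | a x. a \<in> continuous_increments f \<and> x \<in> S}"
  have "S \<subseteq> span Q"
  proof
    fix x assume x: "x \<in> S"
    have "0 \<in> continuous_increments f" by (simp add: continuous_increments_def)
    then have "Ad 0 x \<in> Q" using x unfolding Q_def by blast
    then show "x \<in> span Q" by (simp add: span_base)
  qed
  moreover have "chart_bracket x z \<in> span Q" if x: "x \<in> S" and z: "z \<in> span Q" for x z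
  proof (rule has_vector_derivative_in_subspace[OF subspace_span _ Ad_has_vector_derivative])
    fix t
    have "Ad (t *\<^sub>R x) ` Q \<subseteq> Q"
      using continuous_increments_mult[OF continuous_increments_line[OF f[OF x]]]
      by (auto simp: Q_def simp flip: Ad_mult) blast
    then have "Ad (t *\<^sub>R x) ` span Q \<subseteq> span Q"
      by (metis linear_span_image linear_Ad span_mono)
    then show "Ad (t *\<^sub>R x) z \<in> span Q" using z by blast
  qed
  moreover have "subspace (span Q) \<longrightarrow> S \<subseteq> span Q \<longrightarrow>
      (\<forall>x\<in>S. \<forall>z\<in>span Q. chart_bracket x z \<in> span Q) \<longrightarrow> span Q = UNIV"
    using gen unfolding bracket_generating_def by (rule spec)
  ultimately show "span {Ad a x | a x. a \<in> continuous_increments f \<and> x \<in> S} = UNIV"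
    by (simp add: Q_def)
qed

end

section \<open>Additivity of directional derivatives\<close>

context chart_group
begin

lemma mult_lipschitz_on_ball:
  obtains C where "C \<ge> 0"
    "\<And>x y z. norm x \<le> R \<Longrightarrow> norm y \<le> R \<Longrightarrow> norm z \<le> R \<Longrightarrow> norm (x \<star> y - x \<star> z) \<le> C * norm (y - z)"
    "\<And>x y z. norm x \<le> R \<Longrightarrow> norm y \<le> R \<Longrightarrow> norm z \<le> R \<Longrightarrow> norm (y \<star> x - z \<star> x) \<le> C * norm (y - z)"
proof -
  have "Ck (Suc 0) (\<lambda>(x, y). x \<star> y)" using smooth_mult by (simp only: smooth_def)
  then obtain C where C: "C \<ge> 0"
    "\<And>p q. norm p \<le> R + R \<Longrightarrow> norm q \<le> R + R \<Longrightarrow>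
      norm ((case p of (x, y) \<Rightarrow> x \<star> y) - (case q of (x, y) \<Rightarrow> x \<star> y)) \<le> C * norm (p - q)"
    by (rule Ck_Suc_0_lipschitz_on_cball[where R = "R + R"]) blast
  have pair: "norm (x, y) \<le> R + R" if "norm x \<le> R" "norm y \<le> R" for x y :: 'v
    using that norm_Pair_le[of x y] by linarith
  show thesis
  proof (rule that[OF C(1)])
    fix x y z :: 'v
    assume R: "norm x \<le> R" "norm y \<le> R" "norm z \<le> R"
    show "norm (x \<star> y - x \<star> z) \<le> C * norm (y - z)"
      using C(2)[OF pair[OF R(1,2)] pair[OF R(1,3)]] by simp
    show "norm (y \<star> x - z \<star> x) \<le> C * norm (y - z)"
      using C(2)[OF pair[OF R(2,1)] pair[OF R(3,1)]] by simp
  qed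
qed

text \<open>
  Conjugation by elements of a compact set and left translation by the unit ball distort small displacements at
  most by a constant factor.
\<close>

lemma conj_displacement_bound:
  assumes "compact K"
  obtains C where "C \<ge> 0"
    "\<And>e g v. norm e \<le> 1 \<Longrightarrow> g \<in> K \<Longrightarrow> norm v \<le> 1 \<Longrightarrow> norm (e \<star> (g \<star> v \<star> - g) - e) \<le> C * norm v"
proof -
  have compact: "compact (K \<times> cball (0::'v) 1)"
    using assms by (simp add: compact_Times)
  have "compact ((\<lambda>(g, v). g \<star> v) ` (K \<times> cball 0 1))"
    by (intro compact_continuous_image compact) (auto simp: case_prod_beta intro!: continuous_intros)
  then obtain R1 where R1: "\<And>g v. g \<in> K \<Longrightarrow> norm v \<le> 1 \<Longrightarrow> norm (g \<star> v) \<le> R1"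
    using compact_imp_bounded[THEN bounded_iff[THEN iffD1]] by (fastforce simp: image_iff)
  have "compact ((\<lambda>(g, v). g \<star> v \<star> - g) ` (K \<times> cball 0 1))"
    by (intro compact_continuous_image compact) (auto simp: case_prod_beta intro!: continuous_intros)
  then obtain R2 where R2: "\<And>g v. g \<in> K \<Longrightarrow> norm v \<le> 1 \<Longrightarrow> norm (g \<star> v \<star> - g) \<le> R2"
    using compact_imp_bounded[THEN bounded_iff[THEN iffD1]] by (fastforce simp: image_iff)
  define R where "R = max 1 (max R1 R2)"
  have R: "1 \<le> R" "R1 \<le> R" "R2 \<le> R" by (auto simp: R_def)
  have RK: "norm g \<le> R" if "g \<in> K" for g using R1[OF that, of 0] R by simp
  have R0: "norm (0::'v) \<le> R" using R by simp
  obtain C where C: "C \<ge> 0"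
    and left: "\<And>x y z. norm x \<le> R \<Longrightarrow> norm y \<le> R \<Longrightarrow> norm z \<le> R \<Longrightarrow> norm (x \<star> y - x \<star> z) \<le> C * norm (y - z)"
    and right: "\<And>x y z. norm x \<le> R \<Longrightarrow> norm y \<le> R \<Longrightarrow> norm z \<le> R \<Longrightarrow> norm (y \<star> x - z \<star> x) \<le> C * norm (y - z)"
    using mult_lipschitz_on_ball[of R] by blast
  show thesis
  proof (rule that)
    show "C * (C * C) \<ge> 0" using C by simp
    fix e g v :: 'v
    assume e: "norm e \<le> 1" and g: "g \<in> K" and v: "norm v \<le> 1"
    define c where "c = g \<star> v \<star> - g"
    have "norm (g \<star> v - g \<star> 0) \<le> C * norm (v - 0)"
      using RK[OF g] R v by (intro left) auto
    moreover have "norm (g \<star> v \<star> - g - g \<star> - g) \<le> C * norm (g \<star> v - g)"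
      using RK[OF g] R R1[OF g v] by (intro right) auto
    ultimately have c: "norm c \<le> C * (C * norm v)"
      using C by (simp add: c_def) (meson mult_left_mono order_trans)
    have "norm (e \<star> c - e \<star> 0) \<le> C * norm (c - 0)"
      using R R2[OF g v] e R0 by (intro left) (auto simp: c_def)
    then have "norm (e \<star> c - e) \<le> C * (C * (C * norm v))"
      using mult_left_mono[OF c C] by simp
    then show "norm (e \<star> (g \<star> v \<star> - g) - e) \<le> C * (C * C) * norm v"
      by (simp add: c_def mult.assoc)
  qed
qed

text \<open>
  The derivative of the multiplication at the identity is addition, so \<open>h x \<star> h y\<close> and \<open>h (x + y)\<close>
  differ by \<open>o(h)\<close>.
\<close>

lemma mult_approximates_add:
  assumes k: "k > 0"
  obtains d where "d > 0"
    "\<And>h. \<bar>h\<bar> < d \<Longrightarrow> norm (h *\<^sub>R x \<star> h *\<^sub>R y \<star> - (h *\<^sub>R (x + y))) \<le> k * \<bar>h\<bar>"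
proof -
  have "((\<lambda>h. h *\<^sub>R x) has_derivative (\<lambda>h. h *\<^sub>R x)) (at (0::real))" for x :: 'v
    by (auto intro!: derivative_eq_intros)
  note line = this
  have "((\<lambda>h. h *\<^sub>R x \<star> h *\<^sub>R y \<star> h *\<^sub>R (- (x + y))) has_derivative
      (\<lambda>h. Dmult (0 *\<^sub>R x \<star> 0 *\<^sub>R y, 0 *\<^sub>R (- (x + y))) (Dmult (0 *\<^sub>R x, 0 *\<^sub>R y) (h *\<^sub>R x, h *\<^sub>R y), h *\<^sub>R (- (x + y))))) (at (0::real))"
    by (intro has_derivative_mult line)
  moreover have "h *\<^sub>R x + h *\<^sub>R y + h *\<^sub>R (- (x + y)) = 0" for h
    by (simp add: algebra_simps)
  ultimately have "((\<lambda>h. h *\<^sub>R x \<star> h *\<^sub>R y \<star> h *\<^sub>R (- (x + y))) has_derivative (\<lambda>h. 0)) (at (0::real))"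
    by simp
  then have "((\<lambda>h. h *\<^sub>R x \<star> h *\<^sub>R y \<star> - (h *\<^sub>R (x + y))) has_derivative (\<lambda>h. 0)) (at (0::real))"
    by (simp only: scaleR_minus_right)
  then have "\<exists>d>0. \<forall>h. norm (h - 0) < d \<longrightarrow> norm ((h *\<^sub>R x \<star> h *\<^sub>R y \<star> - (h *\<^sub>R (x + y)))
      - (0 *\<^sub>R x \<star> 0 *\<^sub>R y \<star> - (0 *\<^sub>R (x + y))) - 0) \<le> k * norm (h - 0)"
    using k unfolding has_derivative_at_alt by blast
  then show thesis
    using that by auto
qed

text \<open>
  Replacing the step \<open>r\<close> by the step \<open>q\<close> multiplies the displacement \<open>u \<star> - g\<close> between the two
  orbits on the right by a conjugate of the single-step error \<open>q \<star> - r\<close>.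
\<close>

lemma displacement_step:
  "u \<star> q \<star> - (g \<star> r) = u \<star> - g \<star> (g \<star> (q \<star> - r) \<star> - g)"
  by (simp add: minus_mult assoc)

text \<open>
  The line \<open>t \<mapsto> p \<star> t (x + y)\<close> is compared with the orbit of \<open>p\<close> under the step
  \<open>h x \<star> h y\<close> with \<open>h = 1/n\<close>. Each step displaces the orbit from the line by a further \<open>o(h)\<close>, so
  the total displacement after \<open>n\<close> steps is small, and each increment of \<open>f\<close> along the orbit is
  \<open>h\<close> times the value of \<open>D + E\<close> at the corresponding point of the line, up to \<open>o(h)\<close>.
\<close>

lemma trotter_estimate:
  assumes contf: "continuous_on UNIV f"
    and fx: "deriv_along f x D" and fy: "deriv_along f y E"
    and osc: "\<And>t. t \<in> {0..1} \<Longrightarrow>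
      \<bar>D (p \<star> t *\<^sub>R (x + y)) + E (p \<star> t *\<^sub>R (x + y)) - (D p + E p)\<bar> \<le> \<epsilon>"
  shows "\<bar>f (p \<star> (x + y)) - f p - (D p + E p)\<bar> \<le> \<epsilon>"
proof (rule field_le_epsilon)
  fix \<eta>2 :: real
  assume "\<eta>2 > 0"
  define \<eta> where "\<eta> = \<eta>2 / 2"
  have \<eta>: "\<eta> > 0" using \<open>\<eta>2 > 0\<close> by (simp add: \<eta>_def)
  define z where "z = x + y"
  define \<gamma> where "\<gamma> t = p \<star> t *\<^sub>R z" for t
  define G where "G u = D u + E u" for u
  define \<Psi> where "\<Psi> u h = mean_slope D x u h + mean_slope E y (u \<star> h *\<^sub>R x) h" for u h
  have contD: "continuous_on UNIV D" and contE: "continuous_on UNIV E"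
    using fx fy by (auto simp: deriv_along_def)
  have step: "f (u \<star> (h *\<^sub>R x \<star> h *\<^sub>R y)) - f u = h * \<Psi> u h" for u h
    using increment_eq_mean_slope[OF fx, of u h] increment_eq_mean_slope[OF fy, of "u \<star> h *\<^sub>R x" h]
    by (simp add: \<Psi>_def distrib_left assoc)
  have \<Psi>0: "\<Psi> u 0 = G u" for u by (simp add: \<Psi>_def G_def)
  define K where "K = cball (0::'v) 1 \<times> {0..1::real} \<times> {0..1::real}"
  \<comment> \<open>The triple is (displacement from the line, step size, time); at displacement and step size 0 the value is \<open>G\<close> on the line.\<close>
  have "continuous_on UNIV (\<lambda>k::'v \<times> real \<times> real. \<Psi> (fst k \<star> \<gamma> (snd (snd k))) (fst (snd k)))"
    unfolding \<Psi>_def \<gamma>_def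
    by (intro continuous_on_add continuous_on_mean_slope contD contE continuous_on_group_mult
        continuous_on_scaleR continuous_on_fst continuous_on_snd continuous_on_id continuous_on_const)
  then have "uniformly_continuous_on K (\<lambda>k. \<Psi> (fst k \<star> \<gamma> (snd (snd k))) (fst (snd k)))"
    by (intro compact_uniformly_continuous) (auto simp: K_def compact_Times intro: continuous_on_subset)
  then obtain d0 where d0: "d0 > 0" and uc: "\<And>k k'. k \<in> K \<Longrightarrow> k' \<in> K \<Longrightarrow> dist k' k < d0 \<Longrightarrow>
      dist (\<Psi> (fst k' \<star> \<gamma> (snd (snd k'))) (fst (snd k'))) (\<Psi> (fst k \<star> \<gamma> (snd (snd k))) (fst (snd k))) < \<eta>"
    using \<eta> unfolding uniformly_continuous_on_def by meson
  have slope: "\<bar>\<Psi> (e \<star> \<gamma> t) h - G (\<gamma> t)\<bar> \<le> \<eta>"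
    if "norm e \<le> 1" "norm e < d0 / 2" "0 \<le> h" "h \<le> 1" "h < d0 / 2" "t \<in> {0..1}" for e h t
  proof -
    have "dist (e, h, t) (0, 0, t) \<le> norm e + h"
      using that(3) norm_Pair_le[of e "(h, 0::real)"] norm_Pair_le[of h "0::real"]
      by (simp add: dist_norm)
    then show ?thesis
      using uc[of "(0, 0, t)" "(e, h, t)"] that by (simp add: K_def \<Psi>0 dist_real_def)
  qed
  have "continuous_on UNIV (\<lambda>e. e \<star> \<gamma> 1)"
    by (intro continuous_intros)
  from continuous_on_compose2[OF contf this] have "isCont (\<lambda>e. f (e \<star> \<gamma> 1)) 0"
    by (simp add: continuous_on_eq_continuous_at)
  then obtain d1 where d1: "d1 > 0" and close: "\<And>e. norm e < d1 \<Longrightarrow> \<bar>f (e \<star> \<gamma> 1) - f (\<gamma> 1)\<bar> < \<eta>"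
    using \<eta> unfolding continuous_at_eps_delta by (fastforce simp: dist_norm)
  define d where "d = min 1 (min (d0 / 2) d1)"
  have d: "d > 0" "d \<le> 1" "d \<le> d0 / 2" "d \<le> d1" using d0 d1 by (auto simp: d_def)
  have "compact (\<gamma> ` {0..1})"
    unfolding \<gamma>_def by (intro compact_continuous_image continuous_intros) auto
  then obtain C where C: "C \<ge> 0" and disp: "\<And>e t v. norm e \<le> 1 \<Longrightarrow> t \<in> {0..1} \<Longrightarrow> norm v \<le> 1 \<Longrightarrow>
      norm (e \<star> (\<gamma> t \<star> v \<star> - \<gamma> t) - e) \<le> C * norm v"
    by (rule conj_displacement_bound) blast
  \<comment> \<open>A single-step error of at most \<open>k h\<close> leaves, after conjugation and \<open>n\<close> steps, a displacement of at most \<open>C k < d\<close>.\<close>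
  define k where "k = d / (2 * (C + 1))"
  have k: "k > 0" "C * k < d" "k \<le> 1"
    using C d by (auto simp: k_def field_simps) (smt (verit) mult_nonneg_nonneg)+
  obtain d2 where d2: "d2 > 0"
    and w: "\<And>h. \<bar>h\<bar> < d2 \<Longrightarrow> norm (h *\<^sub>R x \<star> h *\<^sub>R y \<star> - (h *\<^sub>R z)) \<le> k * \<bar>h\<bar>"
    using mult_approximates_add[OF k(1), of x y] unfolding z_def by blast
  obtain n where n: "n > 0" "1 / real n < min d d2"
    using d(1) d2 by (metis min_less_iff_conj nat_approx_posE zero_less_Suc)
  define h where "h = 1 / real n"
  have h: "h > 0" "h < d" "h < d2" "h \<le> 1" "real n * h = 1" using n d by (auto simp: h_def)
  define q where "q = h *\<^sub>R x \<star> h *\<^sub>R y"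
  define u where "u j = ((\<lambda>u. u \<star> q) ^^ j) p" for j
  define e where "e j = u j \<star> - \<gamma> (real j * h)" for j
  have u: "u j = e j \<star> \<gamma> (real j * h)" for j by (simp add: e_def)
  have e_Suc: "e (Suc j) = e j \<star> (\<gamma> (real j * h) \<star> (q \<star> - (h *\<^sub>R z)) \<star> - \<gamma> (real j * h))" for j
  proof -
    have "\<gamma> (real (Suc j) * h) = \<gamma> (real j * h) \<star> h *\<^sub>R z"
      using one_parameter[of "real j * h" h z] by (simp add: \<gamma>_def assoc algebra_simps)
    then show ?thesis
      using displacement_step[of "u j" q "\<gamma> (real j * h)" "h *\<^sub>R z"] by (simp add: e_def u_def)
  qed
  have jh: "real j * h \<in> {0..1}" if "j \<le> n" for j
    using that h mult_right_mono[of "real j" "real n" h] by simp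
  have e_bound: "norm (e j) \<le> C * k * (real j * h)" if "j \<le> n" for j
    using that
  proof (induction j)
    case 0
    then show ?case by (simp add: e_def u_def \<gamma>_def)
  next
    case (Suc j)
    then have IH: "norm (e j) \<le> C * k * (real j * h)" by simp
    also have "\<dots> \<le> C * k * 1"
      using jh[of j] Suc.prems C k by (intro mult_left_mono) auto
    finally have "norm (e j) \<le> 1" using k d by linarith
    moreover have w': "norm (q \<star> - (h *\<^sub>R z)) \<le> k * h" using w[of h] h by (simp add: q_def)
    moreover have "k * h \<le> 1" using k h by (simp add: mult_le_one)
    ultimately have "norm (e (Suc j) - e j) \<le> C * norm (q \<star> - (h *\<^sub>R z))"
      unfolding e_Suc using jh[of j] Suc.prems by (intro disp) auto
    also have "\<dots> \<le> C * (k * h)" using w' C by (rule mult_left_mono)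
    finally have "norm (e (Suc j)) \<le> norm (e j) + C * (k * h)"
      using norm_triangle_ineq2[of "e (Suc j)" "e j"] by linarith
    then show ?case using IH by (simp add: algebra_simps)
  qed
  have e_small: "norm (e j) < d" if "j \<le> n" for j
  proof -
    have "C * k * (real j * h) \<le> C * k * 1"
      using jh[OF that] C k by (intro mult_left_mono) auto
    then show ?thesis using e_bound[OF that] k by linarith
  qed
  have incr: "\<bar>f (u (Suc j)) - f (u j) - h * G p\<bar> \<le> h * (\<eta> + \<epsilon>)" if "j < n" for j
  proof -
    have "f (u (Suc j)) - f (u j) = h * \<Psi> (u j) h"
      using step[of "u j" h] by (simp add: u_def q_def)
    then have "f (u (Suc j)) - f (u j) - h * G p = h * (\<Psi> (u j) h - G p)"
      by (simp add: right_diff_distrib)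
    moreover have "\<bar>\<Psi> (u j) h - G (\<gamma> (real j * h))\<bar> \<le> \<eta>"
      unfolding u using that e_small[of j] d h jh[of j] by (intro slope) auto
    moreover have "\<bar>G (\<gamma> (real j * h)) - G p\<bar> \<le> \<epsilon>"
      using osc[OF jh[of j]] that by (simp add: G_def \<gamma>_def z_def)
    ultimately show ?thesis
      using h by (simp add: abs_mult)
  qed
  have "f (u n) - f p - G p = (\<Sum>j<n. f (u (Suc j)) - f (u j) - h * G p)"
  proof -
    have "(\<Sum>j<n. f (u (Suc j)) - f (u j)) = f (u n) - f (u 0)"
      by (rule sum_lessThan_telescope)
    moreover have "(\<Sum>j<n. h * G p) = real n * h * G p" by simp
    ultimately show ?thesis using h(5) by (simp only: sum_subtractf) (simp add: u_def)
  qed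
  also have "\<bar>\<dots>\<bar> \<le> (\<Sum>j<n. h * (\<eta> + \<epsilon>))"
    by (rule sum_abs[THEN order_trans]) (intro sum_mono incr, simp)
  also have "\<dots> = \<eta> + \<epsilon>" using h by simp
  finally have main: "\<bar>f (u n) - f p - G p\<bar> \<le> \<eta> + \<epsilon>" .
  have "u n = e n \<star> \<gamma> 1" using u[of n] h by simp
  then have "\<bar>f (u n) - f (\<gamma> 1)\<bar> < \<eta>" using close e_small[of n] d by simp
  then have "\<bar>f (\<gamma> 1) - f p - G p\<bar> \<le> \<epsilon> + \<eta>2"
    using main \<eta>_def by linarith
  then show "\<bar>f (p \<star> (x + y)) - f p - (D p + E p)\<bar> \<le> \<epsilon> + \<eta>2"
    by (simp add: \<gamma>_def z_def G_def)
qed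

text \<open>
  Applied to \<open>s x\<close> and \<open>s y\<close>, the estimate bounds the error of the linear approximation by \<open>\<bar>s\<bar>\<close>
  times the oscillation of \<open>D + E\<close> on a segment that shrinks to \<open>p\<close>.
\<close>

lemma deriv_along_add:
  assumes contf: "continuous_on UNIV f"
    and fx: "deriv_along f x D" and fy: "deriv_along f y E"
  shows "deriv_along f (x + y) (\<lambda>p. D p + E p)"
  unfolding deriv_along_def
proof (intro conjI allI)
  have contD: "continuous_on UNIV D" and contE: "continuous_on UNIV E"
    using fx fy by (auto simp: deriv_along_def)
  show contG: "continuous_on UNIV (\<lambda>p. D p + E p)"
    by (intro continuous_intros contD contE)
  fix p
  have "continuous_on UNIV (\<lambda>t. p \<star> t *\<^sub>R (x + y))"
    by (intro continuous_intros)
  from continuous_on_compose2[OF contG this]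
  have "isCont (\<lambda>t. D (p \<star> t *\<^sub>R (x + y)) + E (p \<star> t *\<^sub>R (x + y))) 0"
    by (simp add: continuous_on_eq_continuous_at)
  note cont0 = this
  have "\<exists>d>0. \<forall>s. norm (s - 0) < d \<longrightarrow>
      norm (f (p \<star> s *\<^sub>R (x + y)) - f (p \<star> 0 *\<^sub>R (x + y)) - (D p + E p) * (s - 0)) \<le> \<epsilon> * norm (s - 0)"
    if \<epsilon>: "\<epsilon> > 0" for \<epsilon>
  proof -
    obtain d where d: "d > 0" and osc: "\<And>t. \<bar>t\<bar> < d \<Longrightarrow>
        \<bar>D (p \<star> t *\<^sub>R (x + y)) + E (p \<star> t *\<^sub>R (x + y)) - (D p + E p)\<bar> < \<epsilon>"
      using cont0 \<epsilon> unfolding continuous_at_eps_delta by (fastforce simp: dist_real_def)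
    have "\<bar>f (p \<star> s *\<^sub>R (x + y)) - f p - s * (D p + E p)\<bar> \<le> \<epsilon> * \<bar>s\<bar>" if s: "\<bar>s\<bar> < d" for s
    proof -
      have "\<bar>f (p \<star> (s *\<^sub>R x + s *\<^sub>R y)) - f p - (s * D p + s * E p)\<bar> \<le> \<epsilon> * \<bar>s\<bar>"
      proof (rule trotter_estimate[OF contf deriv_along_scale[OF fx] deriv_along_scale[OF fy]])
        fix t :: real
        assume t: "t \<in> {0..1}"
        define a where "a = p \<star> (t * s) *\<^sub>R (x + y)"
        have "\<bar>t * s\<bar> \<le> \<bar>s\<bar>" using t by (simp add: abs_mult mult_left_le_one_le)
        then have "\<bar>D a + E a - (D p + E p)\<bar> \<le> \<epsilon>"
          using osc[of "t * s"] s by (simp add: a_def)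
        then have "\<bar>s\<bar> * \<bar>D a + E a - (D p + E p)\<bar> \<le> \<bar>s\<bar> * \<epsilon>"
          by (intro mult_left_mono) auto
        moreover have "p \<star> t *\<^sub>R (s *\<^sub>R x + s *\<^sub>R y) = a"
          by (simp add: a_def flip: scaleR_add_right)
        moreover have "s * D a + s * E a - (s * D p + s * E p) = s * (D a + E a - (D p + E p))"
          by (simp add: algebra_simps)
        ultimately show "\<bar>s * D (p \<star> t *\<^sub>R (s *\<^sub>R x + s *\<^sub>R y)) + s * E (p \<star> t *\<^sub>R (s *\<^sub>R x + s *\<^sub>R y))
            - (s * D p + s * E p)\<bar> \<le> \<epsilon> * \<bar>s\<bar>"
          by (simp add: abs_mult mult.commute)
      qed
      then show ?thesis by (simp add: scaleR_add_right distrib_left)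
    qed
    then show ?thesis using d by (auto simp: mult.commute)
  qed
  then show "((\<lambda>t. f (p \<star> t *\<^sub>R (x + y))) has_real_derivative D p + E p) (at 0)"
    unfolding has_field_derivative_def has_derivative_at_alt
    using bounded_linear_mult_right by blast
qed

lemma deriv_along_sum:
  assumes contf: "continuous_on UNIV f"
    and f: "\<And>i. i \<in> I \<Longrightarrow> deriv_along f (x i) (D i)"
  shows "deriv_along f (\<Sum>i\<in>I. r i *\<^sub>R x i) (\<lambda>p. \<Sum>i\<in>I. r i * D i p)"
  using f
proof (induction I rule: infinite_finite_induct)
  case (insert i I)
  then show ?case
    using deriv_along_add[OF contf deriv_along_scale[of f "x i" "D i" "r i"]] by simp
qed (simp_all add: deriv_along_def)

end

section \<open>Exponential coordinates of a Lie group\<close>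

context exponential_lie_group
begin

definition chart_mult :: "'v \<Rightarrow> 'v \<Rightarrow> 'v" where
  "chart_mult x y = lie_log G (lie_exp G x \<otimes> lie_exp G y)"

lemma exp_closed [simp]: "lie_exp G x \<in> carrier G"
  using exp_bij by (auto simp: bij_betw_def)

lemma log_exp [simp]: "lie_log G (lie_exp G x) = x"
  using exp_bij by (simp add: lie_log_def bij_betw_def)

lemma exp_log [simp]: "g \<in> carrier G \<Longrightarrow> lie_exp G (lie_log G g) = g"
  using exp_bij by (simp add: lie_log_def bij_betw_def f_inv_into_f)

lemma exp_chart_mult: "lie_exp G (chart_mult x y) = lie_exp G x \<otimes> lie_exp G y"
  by (simp add: chart_mult_def)

sublocale chart: chart_group chart_mult
proof
  show "smooth (\<lambda>(x, y). chart_mult x y)"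
    using mult_smooth by (simp add: chart_mult_def)
  show "chart_mult (chart_mult x y) z = chart_mult x (chart_mult y z)" for x y z
    by (simp add: chart_mult_def m_assoc)
  show "(s + t) *\<^sub>R x = chart_mult (s *\<^sub>R x) (t *\<^sub>R x)" for s t x
    by (simp add: chart_mult_def flip: exp_one_parameter)
qed

lemma exp_0 [simp]: "lie_exp G 0 = \<one>"
proof -
  have "lie_exp G 0 \<otimes> lie_exp G 0 = lie_exp G 0"
    using exp_chart_mult[of 0 0] by simp
  then show ?thesis by simp
qed

lemma lie_deriv_linear_functional:
  "lie_deriv G x (\<lambda>g. lie_log G g \<bullet> b) (lie_exp G p) = chart.Dmult (p, 0) (0, x) \<bullet> b"
proof -
  have "((\<lambda>t. chart_mult p (t *\<^sub>R x)) has_derivative (\<lambda>h. chart.Dmult (p, 0 *\<^sub>R x) (0, h *\<^sub>R x))) (at (0::real))"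
    by (rule chart.has_derivative_mult) (auto intro!: derivative_eq_intros)
  then have "((\<lambda>t. chart_mult p (t *\<^sub>R x) \<bullet> b) has_derivative (\<lambda>h. chart.Dmult (p, 0) (0, h *\<^sub>R x) \<bullet> b)) (at (0::real))"
    by (intro has_derivative_inner_left) simp
  moreover have "chart.Dmult (p, 0) (0, h *\<^sub>R x) = h *\<^sub>R chart.Dmult (p, 0) (0, x)" for h
    using linear_scale[OF chart.linear_Dmult, of "(p, 0)" h "(0, x)"] by simp
  ultimately have "((\<lambda>t. chart_mult p (t *\<^sub>R x) \<bullet> b) has_real_derivative chart.Dmult (p, 0) (0, x) \<bullet> b) (at 0)"
    by (simp add: has_field_derivative_def mult_commute_abs)
  then show ?thesis
    unfolding lie_deriv_def chart_mult_def by (rule DERIV_imp_deriv)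
qed

lemma smooth_linear_functional: "smooth_on_group G (\<lambda>g. lie_log G g \<bullet> b)"
proof -
  have const: "Ck k (\<lambda>x::'v. c::real)" for k c
    by (induction k arbitrary: c) auto
  have "frechet_derivative (\<lambda>x. x \<bullet> b) (at x) = (\<lambda>h. h \<bullet> b)" for x
    by (rule frechet_derivative_at[symmetric]) (auto intro!: derivative_eq_intros)
  moreover have "(\<lambda>x. x \<bullet> b) differentiable at x" for x
    by (auto intro!: derivative_intros)
  ultimately have "Ck k (\<lambda>x. x \<bullet> b)" for k
    by (cases k) (auto intro!: continuous_intros const)
  then show ?thesis by (simp add: smooth_on_group_def smooth_def)
qed

text \<open>
  The commutator of left-invariant fields is tested on the linear functionals of the logarithm,
  which are smooth and determine a vector through their derivatives at the identity.
\<close>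

lemma bracket_eq_chart_bracket: "bracket G x y = chart.chart_bracket x y"
proof (rule euclidean_eqI)
  fix b :: 'v
  define f where "f g = lie_log G g \<bullet> b" for g
  have lin: "lie_deriv G z f (lie_exp G p) = chart.Dmult (p, 0) (0, z) \<bullet> b" for z p
    unfolding f_def by (rule lie_deriv_linear_functional)
  have second: "lie_deriv G w (lie_deriv G z f) \<one> = chart.D2mult (0, z) (w, 0) \<bullet> b" for w z
  proof -
    have "((\<lambda>t. chart.Dmult (t *\<^sub>R w, t *\<^sub>R 0) (0, z) \<bullet> b) has_vector_derivative
        chart.D2mult (0, z) (w, 0) \<bullet> b) (at 0)"
      by (rule bounded_linear.has_vector_derivative[OF bounded_linear_inner_left chart.Dmult_along_line])
    then have "((\<lambda>t. lie_deriv G z f (\<one> \<otimes> lie_exp G (t *\<^sub>R w))) has_real_derivative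
        chart.D2mult (0, z) (w, 0) \<bullet> b) (at 0)"
      by (simp add: lin has_real_derivative_iff_has_vector_derivative)
    then show ?thesis
      unfolding lie_deriv_def[of G w] by (rule DERIV_imp_deriv)
  qed
  have "lie_deriv G (bracket G x y) f \<one>
      = lie_deriv G x (lie_deriv G y f) \<one> - lie_deriv G y (lie_deriv G x f) \<one>"
    unfolding f_def by (intro bracket_commutator smooth_linear_functional) simp
  then show "bracket G x y \<bullet> b = chart.chart_bracket x y \<bullet> b"
    using lin[of _ 0] by (simp add: second chart.chart_bracket_def inner_diff_left)
qed

lemma Gamma1_deriv_along:
  assumes "f \<in> Gamma1 G m X" "i \<in> {1..m}"
  shows "chart.deriv_along (\<lambda>x. f (lie_exp G x)) (X i) (\<lambda>x. lie_deriv G (X i) f (lie_exp G x))"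
  unfolding chart.deriv_along_def
proof (intro conjI allI)
  show "continuous_on UNIV (\<lambda>x. lie_deriv G (X i) f (lie_exp G x))"
    using assms by (simp add: Gamma1_def continuous_on_group_def)
  fix p
  have "(\<lambda>t::real. f (lie_exp G p \<otimes> lie_exp G (t *\<^sub>R X i))) differentiable at 0"
    using assms by (simp add: Gamma1_def)
  then show "((\<lambda>t. f (lie_exp G (chart_mult p (t *\<^sub>R X i)))) has_real_derivative
      lie_deriv G (X i) f (lie_exp G p)) (at 0)"
    by (simp add: lie_deriv_def exp_chart_mult DERIV_deriv_iff_real_differentiable)
qed

end

section \<open>Horizontal derivatives in a Carnot group\<close>

lemma orthonormal_frame_expansion:
  assumes X: "orthonormal_frame G m X" and y: "y \<in> layer G 1"
  shows "y = (\<Sum>i=1..m. (y \<bullet> X i) *\<^sub>R X i)"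
proof -
  have "y \<in> span (X ` {1..m})" using X y by (simp add: orthonormal_frame_def)
  then show ?thesis
  proof (induction rule: span_induct_alt)
    case base
    show ?case by simp
  next
    case (step c x z)
    then obtain j where j: "j \<in> {1..m}" "x = X j" by blast
    have "(\<Sum>i=1..m. (x \<bullet> X i) *\<^sub>R X i) = (\<Sum>i=1..m. if j = i then X i else 0)"
      using X j by (intro sum.cong) (auto simp: orthonormal_frame_def)
    also have "\<dots> = x" using j by simp
    finally have "(\<Sum>i=1..m. ((c *\<^sub>R x + z) \<bullet> X i) *\<^sub>R X i) = c *\<^sub>R x + (\<Sum>i=1..m. (z \<bullet> X i) *\<^sub>R X i)"
      by (simp add: inner_add_left scaleR_add_left sum.distrib flip: scaleR_scaleR scaleR_sum_right)
    then show ?case using step by simp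
  qed
qed

context carnot_group
begin

text \<open>
  The first layer generates the Lie algebra layer by layer; linearity of the bracket in its first
  argument passes from the frame to the whole first layer.
\<close>

lemma frame_bracket_generating:
  assumes X: "orthonormal_frame G m X"
  shows "chart.bracket_generating (X ` {1..m})"
  unfolding chart.bracket_generating_def
proof (intro allI impI)
  fix W
  assume W: "subspace W" and XW: "X ` {1..m} \<subseteq> W"
    and inv: "\<forall>x\<in>X ` {1..m}. \<forall>z\<in>W. chart.chart_bracket x z \<in> W"
  have span: "span (X ` {1..m}) = layer G 1" using X by (simp add: orthonormal_frame_def)
  have closed: "bracket G x z \<in> W" if x: "x \<in> layer G 1" and z: "z \<in> W" for x z
  proof -
    have "subspace {x. chart.chart_bracket x z \<in> W}"
      using W linear_0[OF chart.linear_chart_bracket_left] linear_add[OF chart.linear_chart_bracket_left]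
        linear_scale[OF chart.linear_chart_bracket_left]
      by (auto simp: subspace_def)
    then have "span (X ` {1..m}) \<subseteq> {x. chart.chart_bracket x z \<in> W}"
      using inv z by (intro span_minimal) auto
    then show ?thesis using x unfolding span bracket_eq_chart_bracket by blast
  qed
  have layers: "layer G j \<subseteq> W" if "1 \<le> j" "j \<le> step G" for j
    using that
  proof (induction j rule: dec_induct)
    case base
    show ?case using span_minimal[OF XW W] unfolding span .
  next
    case (step j)
    then have "{bracket G x y | x y. x \<in> layer G 1 \<and> y \<in> layer G j} \<subseteq> W"
      using closed by auto
    then have "span {bracket G x y | x y. x \<in> layer G 1 \<and> y \<in> layer G j} \<subseteq> W"
      using W by (rule span_minimal)
    then show ?case using layer_generated[of j] step by simp
  qed
  show "W = UNIV"
  proof (rule UNIV_eq_I[symmetric])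
    fix x
    obtain w where w: "layer_decomposition G x w" using direct_sum by blast
    have "w j \<in> W" if "j \<in> {1..step G}" for j
      using w that layers[of j] unfolding layer_decomposition_def by auto
    then have "(\<Sum>j=1..step G. w j) \<in> W" using W by (intro subspace_sum)
    then show "x \<in> W" using w by (simp add: layer_decomposition_def)
  qed
qed

text \<open>
  The first layer is the span of the frame, so \<open>y\<close> is the combination of the \<open>X\<^sub>i\<close> with
  coefficients \<open>y \<bullet> X\<^sub>i\<close>; additivity of the directional derivatives gives the formula.
\<close>

lemma horizontal_derivative:
  assumes f: "f \<in> Gamma1 G m X" and X: "orthonormal_frame G m X"
    and y: "y \<in> layer G 1" and g: "g \<in> carrier G"
  shows "((\<lambda>t. f (g \<otimes> lie_exp G (t *\<^sub>R y))) has_real_derivative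
    horizontal_gradient G m X f (g \<otimes> lie_exp G (t *\<^sub>R y)) \<bullet> y) (at t)"
proof -
  let ?F = "\<lambda>x. f (lie_exp G x)"
  have along: "chart.deriv_along ?F (X i) (\<lambda>x. lie_deriv G (X i) f (lie_exp G x))" if "i \<in> {1..m}" for i
    using f that by (rule Gamma1_deriv_along)
  have "\<exists>D. \<forall>x\<in>X ` {1..m}. chart.deriv_along ?F x (D x)"
    using along by (intro bchoice) blast
  then have cont: "continuous_on UNIV ?F"
    using chart.continuous_of_bracket_generating[OF frame_bracket_generating[OF X]] by blast
  have grad: "horizontal_gradient G m X f h \<bullet> y = (\<Sum>i=1..m. (y \<bullet> X i) * lie_deriv G (X i) f h)" for h
    by (simp add: horizontal_gradient_def inner_sum_left inner_commute[of y] mult.commute)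
  have "chart.deriv_along ?F y (\<lambda>x. horizontal_gradient G m X f (lie_exp G x) \<bullet> y)"
    unfolding grad
    using chart.deriv_along_sum[OF cont along, of "{1..m}" "\<lambda>i. i" "\<lambda>i. y \<bullet> X i"]
    by (simp only: orthonormal_frame_expansion[OF X y, symmetric])
  from chart.deriv_along_line[OF this, of "lie_log G g" t]
  show ?thesis using g by (simp add: exp_chart_mult)
qed

end

section \<open>Geometry of horizontal lines\<close>

context carnot_group
begin

lemma xi_exp_horizontal:
  assumes y: "y \<in> layer G 1"
  shows "xi G j (lie_exp G y) = (if j = 1 then y else 0)"
proof -
  have "layer_decomposition G y (\<lambda>j. if j = 1 then y else 0)"
    using y step_pos layer_subspace by (auto simp: layer_decomposition_def subspace_0)
  then have "(THE w. layer_decomposition G y w) = (\<lambda>j. if j = 1 then y else 0)"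
    using direct_sum by (rule the1_equality[rotated])
  then show ?thesis by (simp add: xi_def)
qed

lemma dilation_exp_horizontal:
  assumes "y \<in> layer G 1"
  shows "dilation G l (lie_exp G y) = lie_exp G (l *\<^sub>R y)"
proof -
  have "(\<Sum>j=1..step G. l ^ j *\<^sub>R xi G j (lie_exp G y)) = (\<Sum>j=1..step G. if 1 = j then l *\<^sub>R y else 0)"
    using assms by (intro sum.cong) (auto simp: xi_exp_horizontal)
  also have "\<dots> = l *\<^sub>R y" using step_pos by simp
  finally show ?thesis by (simp add: dilation_def)
qed

lemma gauge_norm_exp_horizontal:
  assumes "y \<in> layer G 1"
  shows "gauge_norm G (lie_exp G y) = norm y"
proof -
  have "(\<Sum>i=1..step G. norm (xi G i (lie_exp G y)) powr (2 * fact (step G) / real i))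
      = (\<Sum>i=1..step G. if 1 = i then norm y powr (2 * fact (step G)) else 0)"
    using assms by (intro sum.cong) (auto simp: xi_exp_horizontal)
  also have "\<dots> = norm y powr (2 * fact (step G))" using step_pos by simp
  finally show ?thesis by (simp add: gauge_norm_def powr_powr)
qed

lemma layer1_scale: "y \<in> layer G 1 \<Longrightarrow> r *\<^sub>R y \<in> layer G 1"
  using layer_subspace[of 1] step_pos by (simp add: subspace_scale)

lemma horizontal_line_step:
  assumes "g \<in> carrier G"
  shows "g \<otimes> lie_exp G (t *\<^sub>R y) = g \<otimes> lie_exp G (s *\<^sub>R y) \<otimes> lie_exp G ((t - s) *\<^sub>R y)"
  using assms exp_one_parameter[of s "t - s" y] by (simp add: m_assoc)

lemma gauge_dist_horizontal_line:
  assumes "g \<in> carrier G" "y \<in> layer G 1"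
  shows "gauge_dist G (g \<otimes> lie_exp G (s *\<^sub>R y)) (g \<otimes> lie_exp G (t *\<^sub>R y)) = \<bar>t - s\<bar> * norm y"
proof -
  have "inv h \<otimes> (h \<otimes> e) = e" if "h \<in> carrier G" "e \<in> carrier G" for h e
    using that by (simp flip: m_assoc)
  then show ?thesis
    using assms horizontal_line_step[of g t y s]
      gauge_norm_exp_horizontal[OF layer1_scale[OF assms(2), of "t - s"]]
    by (simp add: gauge_dist_def)
qed

lemma H_segment_horizontal:
  assumes "g \<in> carrier G" "y \<in> layer G 1"
  shows "H_segment G g (g \<otimes> lie_exp G y) l = g \<otimes> lie_exp G (l *\<^sub>R y)"
  using assms by (simp add: H_segment_def dilation_exp_horizontal flip: m_assoc)

lemma horizontal_line_in_plane:
  assumes "g \<in> carrier G" "y \<in> layer G 1"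
  shows "g \<otimes> lie_exp G (t *\<^sub>R y) \<in> horizontal_plane G (g \<otimes> lie_exp G (s *\<^sub>R y))"
  unfolding horizontal_plane_def
  using horizontal_line_step[OF assms(1), of t y s] layer1_scale[OF assms(2)] by blast

end

section \<open>Semiconvexity\<close>

text \<open>
  Under this bound \<open>u' t + 2 A t\<close> is nondecreasing, so \<open>u t + A t\<^sup>2\<close> is convex.
\<close>

lemma semiconvex_of_derivative_bound:
  fixes u :: "real \<Rightarrow> real"
  assumes u: "\<And>t. t \<in> {0..1} \<Longrightarrow> (u has_real_derivative u' t) (at t)"
    and lip: "\<And>s t. s \<in> {0..1} \<Longrightarrow> t \<in> {0..1} \<Longrightarrow> \<bar>u' t - u' s\<bar> \<le> 2 * A * \<bar>t - s\<bar>"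
    and l: "l \<in> {0..1}"
  shows "u l \<le> (1 - l) * u 0 + l * u 1 + A * l * (1 - l)"
proof -
  have "convex_on {0..1} (\<lambda>t. u t + A * t\<^sup>2)"
  proof (rule convex_on_realI)
    show "((\<lambda>t. u t + A * t\<^sup>2) has_real_derivative u' t + 2 * A * t) (at t)" if "t \<in> {0..1}" for t
      using u[OF that] by (auto intro!: derivative_eq_intros)
    show "u' s + 2 * A * s \<le> u' t + 2 * A * t" if "s \<in> {0..1}" "t \<in> {0..1}" "s \<le> t" for s t
      using lip[OF that(1,2)] that(3) by (simp add: abs_le_iff algebra_simps)
  qed simp
  from convex_onD[OF this, of l 0 1] l
  have "u l + A * l\<^sup>2 \<le> (1 - l) * u 0 + l * (u 1 + A)" by simp
  then show ?thesis by (simp add: algebra_simps power2_eq_square)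
qed

theorem theorem5p1:
  fixes G :: "('g, 'v::euclidean_space, 'z) carnot_scheme"
    and m :: nat and X :: "nat \<Rightarrow> 'v"
    and \<Omega> :: "'g set" and c :: "'g \<Rightarrow> 'v \<Rightarrow> real" and \<psi> :: "'g \<Rightarrow> ereal"
  assumes carnot: "carnot_group G"
    and balls_H_convex: "\<forall>B\<in>gauge_balls G. H_convex G B"
    and frame: "orthonormal_frame G m X"
    and Omega: "\<Omega> \<subseteq> carrier G"
    and c_regular: "\<forall>v\<in>layer G 1. (\<lambda>g. c g v) \<in> Gamma11_loc G m X"
    and c_uniform:
      "\<forall>B\<in>gauge_balls G. B \<subseteq> \<Omega> \<longrightarrow>
        (\<exists>K>0. \<forall>g\<in>B. \<forall>g'\<in>B. \<forall>v\<in>layer G 1.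
          norm (horizontal_gradient G m X (\<lambda>h. c h v) g' - horizontal_gradient G m X (\<lambda>h. c h v) g)
            \<le> 2 * K * gauge_dist G g' g)"
    and psi: "c_H_convex G c \<Omega> \<psi>"
  shows "locally_H_semiconvex G \<Omega> \<psi>"
  unfolding locally_H_semiconvex_def
proof (intro ballI impI)
  interpret carnot_group G by (rule carnot)
  fix B
  assume B: "B \<in> gauge_balls G" and B\<Omega>: "B \<subseteq> \<Omega>"
  have conv: "H_convex G B" using balls_H_convex B by blast
  have BG: "B \<subseteq> carrier G" using B\<Omega> Omega by blast
  obtain K where K: "K > 0" and lip: "\<And>g g' v. g \<in> B \<Longrightarrow> g' \<in> B \<Longrightarrow> v \<in> layer G 1 \<Longrightarrow>
      norm (horizontal_gradient G m X (\<lambda>h. c h v) g' - horizontal_gradient G m X (\<lambda>h. c h v) g)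
        \<le> 2 * K * gauge_dist G g' g"
    using c_uniform B B\<Omega> by meson
  have "\<psi> (H_segment G g g' l) \<le> ereal (1 - l) * \<psi> g + ereal l * \<psi> g'
      + ereal (K * l * (1 - l) * (norm (xi G 1 (inv\<^bsub>G\<^esub> g \<otimes>\<^bsub>G\<^esub> g')))\<^sup>2)"
    if g: "g \<in> B" and g': "g' \<in> horizontal_plane G g \<inter> B" and l: "l \<in> {0..1}" for g g' l
  proof -
    obtain y where y: "y \<in> layer G 1" and g'_eq: "g' = g \<otimes>\<^bsub>G\<^esub> lie_exp G y"
      using g' by (auto simp: horizontal_plane_def)
    have gG: "g \<in> carrier G" using g BG by blast
    define \<gamma> where "\<gamma> t = g \<otimes>\<^bsub>G\<^esub> lie_exp G (t *\<^sub>R y)" for t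
    have \<gamma>: "\<gamma> 0 = g" "\<gamma> 1 = g'" using gG by (simp_all add: \<gamma>_def g'_eq)
    have \<gamma>_seg: "H_segment G g g' t = \<gamma> t" for t
      unfolding \<gamma>_def g'_eq by (rule H_segment_horizontal[OF gG y])
    have \<gamma>B: "\<gamma> t \<in> B" if "t \<in> {0..1}" for t
      using conv g g' that unfolding H_convex_def \<gamma>_seg[symmetric] by blast
    have c_semiconvex: "c (\<gamma> l) v \<le> (1 - l) * c g v + l * c g' v + K * l * (1 - l) * (norm y)\<^sup>2"
      if v: "v \<in> layer G 1" for v
    proof -
      define D where "D t = horizontal_gradient G m X (\<lambda>h. c h v) (\<gamma> t)" for t
      have c: "(\<lambda>h. c h v) \<in> Gamma1 G m X"
        using c_regular v by (simp add: Gamma11_loc_def)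
      have deriv: "((\<lambda>t. c (\<gamma> t) v) has_real_derivative D t \<bullet> y) (at t)" for t
        unfolding \<gamma>_def D_def by (rule horizontal_derivative[OF c frame y gG])
      have "\<bar>D t \<bullet> y - D s \<bullet> y\<bar> \<le> 2 * (K * (norm y)\<^sup>2) * \<bar>t - s\<bar>"
        if "s \<in> {0..1}" "t \<in> {0..1}" for s t
      proof -
        have "\<bar>D t \<bullet> y - D s \<bullet> y\<bar> \<le> norm (D t - D s) * norm y"
          using Cauchy_Schwarz_ineq2[of "D t - D s" y] by (simp add: inner_diff_left)
        also have "\<dots> \<le> 2 * K * gauge_dist G (\<gamma> t) (\<gamma> s) * norm y"
          unfolding D_def using that v by (intro mult_right_mono lip \<gamma>B) auto
        also have "gauge_dist G (\<gamma> t) (\<gamma> s) = \<bar>t - s\<bar> * norm y"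
          unfolding \<gamma>_def using gauge_dist_horizontal_line[OF gG y, of t s] by (simp add: abs_minus_commute)
        finally show ?thesis by (simp add: power2_eq_square mult_ac)
      qed
      from semiconvex_of_derivative_bound[OF deriv this l] show ?thesis
        by (simp add: \<gamma> mult_ac)
    qed
    \<comment> \<open>Both end points lie in the horizontal plane of the intermediate point, so the inequality that defines a minorant there holds at both of them.\<close>
    have \<gamma>\<Omega>: "\<gamma> l \<in> \<Omega>" and "g \<in> \<Omega>" "g' \<in> \<Omega>" using \<gamma>B[OF l] g g' B\<Omega> by auto
    then have plane: "g \<in> horizontal_plane G (\<gamma> l) \<inter> \<Omega>" "g' \<in> horizontal_plane G (\<gamma> l) \<inter> \<Omega>"
      using horizontal_line_in_plane[OF gG y, of 0 l] horizontal_line_in_plane[OF gG y, of 1 l] \<gamma>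
      unfolding \<gamma>_def by auto
    have "\<psi> (\<gamma> l) = (SUP (v, \<alpha>)\<in>c_minorants G c \<Omega> \<psi> (\<gamma> l). ereal (c (\<gamma> l) v + \<alpha>))"
      using psi \<gamma>\<Omega> by (simp add: c_H_convex_def)
    also have "\<dots> \<le> ereal (1 - l) * \<psi> g + ereal l * \<psi> g' + ereal (K * l * (1 - l) * (norm y)\<^sup>2)"
    proof (rule SUP_least, clarify)
      fix v \<alpha>
      assume "(v, \<alpha>) \<in> c_minorants G c \<Omega> \<psi> (\<gamma> l)"
      then have v: "v \<in> layer G 1" and le: "ereal (c g v + \<alpha>) \<le> \<psi> g" "ereal (c g' v + \<alpha>) \<le> \<psi> g'"
        using plane unfolding c_minorants_def by auto
      have "ereal (c (\<gamma> l) v + \<alpha>) \<le> ereal (1 - l) * ereal (c g v + \<alpha>) + ereal l * ereal (c g' v + \<alpha>)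
          + ereal (K * l * (1 - l) * (norm y)\<^sup>2)"
        using c_semiconvex[OF v] by (simp add: algebra_simps)
      also have "\<dots> \<le> ereal (1 - l) * \<psi> g + ereal l * \<psi> g' + ereal (K * l * (1 - l) * (norm y)\<^sup>2)"
        using l by (intro add_mono ereal_mult_left_mono le order_refl) auto
      finally show "ereal (c (\<gamma> l) v + \<alpha>)
          \<le> ereal (1 - l) * \<psi> g + ereal l * \<psi> g' + ereal (K * l * (1 - l) * (norm y)\<^sup>2)" .
    qed
    finally show ?thesis
      using gG xi_exp_horizontal[OF y, of 1] unfolding \<gamma>_seg by (simp add: g'_eq flip: m_assoc)
  qed
  moreover have "\<forall>g\<in>B. \<psi> g \<noteq> -\<infinity>"
    using psi B\<Omega> by (auto simp: c_H_convex_def proper_on_def)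
  ultimately show "H_semiconvex_on G B \<psi>"
    unfolding H_semiconvex_on_def using conv K by blast
qed

end
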